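(* Let $f:\mathbb{R}^{n_1}\to\mathbb{R}$ and $g:\mathbb{R}^{n_2}\to\mathbb{R}$ be convex, continuously differentiable functions such that $\nabla f$ and $\nabla g$ are locally Lipschitz continuous. Let $\gamma:[t_0,+\infty)\to(0,+\infty)$ be a nonincreasing and twice continuously differentiable function satisfying $$\ddot{\gamma}(t)\ge 2\beta^2\gamma(t)^3\qquad \forall t\ge t_0$$ for some $\beta\in(0,\frac13)$, and let $\delta(t)=\frac{1}{\beta_0\gamma(t)}$ with $\beta_0\in[2\beta,1-\beta)$. Let $(x^*,y^*,\lambda^* )\in\Omega$ and let $(x(t),y(t),\lambda(t))$ be the unique solution of the dynamical system (S) (given in the context), for some initial value of $(x,y,\lambda,\dot x,\dot y,\dot\lambda)$ at $t_0$, defined on a maximal interval $[t_0,T)$ with $T\le+\infty$. Then: (a) There exist positive functions $\theta(t)$ and $\eta(t)$ on $[t_0,+\infty)$ such that the energy function $\mathcal{E}_{\theta,\eta}^{\beta}$ (defined in the context) satisfies $\dot{\mathcal{E}}_{\theta,\eta}^{\beta}(t)\le 0$ for all $t\in[t_0,T)$. As a consequence, the function $\mathcal{E}_{\theta,\eta}^{\beta}(t)$ is nonincreasing on $[t_0,T)$. (b) $T=+\infty$.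
   Context: All spaces are Euclidean with inner product $\langle\cdot,\cdot\rangle$ and norm $\|\cdot\|$; $t_0>0$ is fixed. $A\in\mathbb{R}^{m\times n_1}$, $B\in\mathbb{R}^{m\times n_2}$, $b\in\mathbb{R}^m$. $\Omega$ is the set of $(x^*,y^*,\lambda^* )\in\mathbb{R}^{n_1}\times\mathbb{R}^{n_2}\times\mathbb{R}^m$ with $-A^T\lambda^*=\nabla f(x^* )$, $-B^T\lambda^*=\nabla g(y^* )$, $Ax^*+By^*-b=0$; it is assumed that $\Omega\neq\emptyset$. The augmented Lagrangian is $$\mathcal{L}(x,y,\lambda)=f(x)+g(y)+\langle\lambda,Ax+By-b\rangle+\tfrac12\|Ax+By-b\|^2.$$ The dynamical system (S) is $$\begin{cases}\ddot{x}(t)+\gamma(t)\dot{x}(t)=-\nabla f(x(t))-A^T(\lambda(t)+\delta(t)\dot\lambda(t))-A^T(Ax(t)+By(t)-b),\\ \ddot{y}(t)+\gamma(t)\dot{y}(t)=-\nabla g(y(t))-B^T(\lambda(t)+\delta(t)\dot\lambda(t))-B^T(Ax(t)+By(t)-b),\\ \ddot{\lambda}(t)+\gamma(t)\dot{\lambda}(t)=A(x(t)+\delta(t)\dot{x}(t))+B(y(t)+\delta(t)\dot{y}(t))-b.\end{cases}$$ Solutions are twice continuously differentiable; under the stated hypotheses each initial value $(x(t_0),y(t_0),\lambda(t_0),\dot x(t_0),\dot y(t_0),\dot\lambda(t_0))$ yields a unique solution on a maximal interval $[t_0,T)\subset[t_0,+\infty)$. Let $p(t)=e^{\int_{t_0}^t\gamma(s)\,ds}$.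 For functions $\theta,\eta:[t_0,+\infty)\to[0,+\infty)$, the energy function $\mathcal{E}_{\theta,\eta}^{\beta}:[t_0,T)\to[0,+\infty)$ is $$\mathcal{E}_{\theta,\eta}^{\beta}(t)=p(t)^{2\beta}\big(\mathcal{L}(x(t),y(t),\lambda^* )-\mathcal{L}(x^*,y^*,\lambda^* )\big)+\mathcal{E}_1(t)+\mathcal{E}_2(t)+\mathcal{E}_3(t),$$ $$\mathcal{E}_1(t)=\tfrac12\|\theta(t)(x(t)-x^* )+p(t)^\beta\dot x(t)\|^2+\tfrac{\eta(t)}{2}\|x(t)-x^*\|^2,$$ $$\mathcal{E}_2(t)=\tfrac12\|\theta(t)(y(t)-y^* )+p(t)^\beta\dot y(t)\|^2+\tfrac{\eta(t)}{2}\|y(t)-y^*\|^2,$$ $$\mathcal{E}_3(t)=\tfrac12\|\theta(t)(\lambda(t)-\lambda^* )+p(t)^\beta\dot\lambda(t)\|^2+\tfrac{\eta(t)}{2}\|\lambda(t)-\lambda^*\|^2.$$ *)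

theory Defs
  imports "HOL-Analysis.Analysis"
begin

definition grad :: "('a::real_inner \<Rightarrow> real) \<Rightarrow> 'a \<Rightarrow> 'a" where
  "grad f x = (THE D. GDERIV f x :> D)"

definition cont_diff :: "('a::real_inner \<Rightarrow> real) \<Rightarrow> bool" where
  "cont_diff f \<longleftrightarrow> (\<forall>x. f differentiable (at x)) \<and> continuous_on UNIV (grad f)"

definition locally_lipschitz :: "('a::metric_space \<Rightarrow> 'b::metric_space) \<Rightarrow> bool" where
  "locally_lipschitz F \<longleftrightarrow> (\<forall>x. \<exists>r>0. \<exists>L. L-lipschitz_on (cball x r) F)"

(* Derivative of a curve relative to the interval I on which it lives; it is one-sided at an
   endpoint of I that belongs to I. *)
definition tderiv :: "real set \<Rightarrow> (real \<Rightarrow> 'a::real_normed_vector) \<Rightarrow> real \<Rightarrow> 'a" where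
  "tderiv I u t = vector_derivative u (at t within I)"

definition C2_on :: "real set \<Rightarrow> (real \<Rightarrow> 'a::real_normed_vector) \<Rightarrow> bool" where
  "C2_on I u \<longleftrightarrow> u differentiable_on I \<and> tderiv I u differentiable_on I \<and>
     continuous_on I (tderiv I (tderiv I u))"

(* The interval [t0, T), where T may be infinite. *)
definition tint :: "real \<Rightarrow> ereal \<Rightarrow> real set" where
  "tint t0 T = {t. t0 \<le> t \<and> ereal t < T}"

definition Omega :: "(real^'n1 \<Rightarrow> real) \<Rightarrow> (real^'n2 \<Rightarrow> real) \<Rightarrow> real^'n1^'m \<Rightarrow> real^'n2^'m \<Rightarrow> real^'m
    \<Rightarrow> ((real^'n1) \<times> (real^'n2) \<times> (real^'m)) set" where
  "Omega f g A B b = {(xs, ys, ls).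
     - (transpose A *v ls) = grad f xs \<and>
     - (transpose B *v ls) = grad g ys \<and>
     A *v xs + B *v ys - b = 0}"

definition aug_lagrangian :: "(real^'n1 \<Rightarrow> real) \<Rightarrow> (real^'n2 \<Rightarrow> real) \<Rightarrow> real^'n1^'m \<Rightarrow> real^'n2^'m
    \<Rightarrow> real^'m \<Rightarrow> real^'n1 \<Rightarrow> real^'n2 \<Rightarrow> real^'m \<Rightarrow> real" where
  "aug_lagrangian f g A B b x y l =
     f x + g y + l \<bullet> (A *v x + B *v y - b) + 1/2 * (norm (A *v x + B *v y - b))\<^sup>2"

definition solution_S :: "(real^'n1 \<Rightarrow> real) \<Rightarrow> (real^'n2 \<Rightarrow> real) \<Rightarrow> real^'n1^'m \<Rightarrow> real^'n2^'m
    \<Rightarrow> real^'m \<Rightarrow> (real \<Rightarrow> real) \<Rightarrow> (real \<Rightarrow> real) \<Rightarrow> real \<Rightarrow> ereal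
    \<Rightarrow> (real \<Rightarrow> real^'n1) \<Rightarrow> (real \<Rightarrow> real^'n2) \<Rightarrow> (real \<Rightarrow> real^'m) \<Rightarrow> bool" where
  "solution_S f g A B b \<gamma> \<delta> t0 T x y l \<longleftrightarrow>
     (let I = tint t0 T in
       ereal t0 < T \<and> C2_on I x \<and> C2_on I y \<and> C2_on I l \<and>
       (\<forall>t\<in>I.
          tderiv I (tderiv I x) t + \<gamma> t *\<^sub>R tderiv I x t =
            - grad f (x t) - transpose A *v (l t + \<delta> t *\<^sub>R tderiv I l t)
            - transpose A *v (A *v x t + B *v y t - b) \<and>
          tderiv I (tderiv I y) t + \<gamma> t *\<^sub>R tderiv I y t =
            - grad g (y t) - transpose B *v (l t + \<delta> t *\<^sub>R tderiv I l t)
            - transpose B *v (A *v x t + B *v y t - b) \<and>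
          tderiv I (tderiv I l) t + \<gamma> t *\<^sub>R tderiv I l t =
            A *v (x t + \<delta> t *\<^sub>R tderiv I x t) + B *v (y t + \<delta> t *\<^sub>R tderiv I y t) - b))"

definition maximal_solution_S :: "(real^'n1 \<Rightarrow> real) \<Rightarrow> (real^'n2 \<Rightarrow> real) \<Rightarrow> real^'n1^'m
    \<Rightarrow> real^'n2^'m \<Rightarrow> real^'m \<Rightarrow> (real \<Rightarrow> real) \<Rightarrow> (real \<Rightarrow> real) \<Rightarrow> real \<Rightarrow> ereal
    \<Rightarrow> (real \<Rightarrow> real^'n1) \<Rightarrow> (real \<Rightarrow> real^'n2) \<Rightarrow> (real \<Rightarrow> real^'m) \<Rightarrow> bool" where
  "maximal_solution_S f g A B b \<gamma> \<delta> t0 T x y l \<longleftrightarrow>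
     solution_S f g A B b \<gamma> \<delta> t0 T x y l \<and>
     \<not> (\<exists>T' x' y' l'. T < T' \<and> solution_S f g A B b \<gamma> \<delta> t0 T' x' y' l' \<and>
          (\<forall>t\<in>tint t0 T. x' t = x t \<and> y' t = y t \<and> l' t = l t))"

definition pfun :: "(real \<Rightarrow> real) \<Rightarrow> real \<Rightarrow> real \<Rightarrow> real" where
  "pfun \<gamma> t0 t = exp (integral {t0..t} \<gamma>)"

(* The common form of E_1, E_2, E_3, for a curve u and the reference point us. *)
definition energy_part :: "(real \<Rightarrow> real) \<Rightarrow> real \<Rightarrow> real \<Rightarrow> ereal \<Rightarrow> (real \<Rightarrow> real) \<Rightarrow> (real \<Rightarrow> real)
    \<Rightarrow> (real \<Rightarrow> 'a::real_normed_vector) \<Rightarrow> 'a \<Rightarrow> real \<Rightarrow> real" where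
  "energy_part \<gamma> \<beta> t0 T \<theta> \<eta> u us t =
     1/2 * (norm (\<theta> t *\<^sub>R (u t - us) + (pfun \<gamma> t0 t powr \<beta>) *\<^sub>R tderiv (tint t0 T) u t))\<^sup>2
     + \<eta> t / 2 * (norm (u t - us))\<^sup>2"

definition energy :: "(real^'n1 \<Rightarrow> real) \<Rightarrow> (real^'n2 \<Rightarrow> real) \<Rightarrow> real^'n1^'m \<Rightarrow> real^'n2^'m
    \<Rightarrow> real^'m \<Rightarrow> (real \<Rightarrow> real) \<Rightarrow> real \<Rightarrow> real \<Rightarrow> ereal
    \<Rightarrow> (real \<Rightarrow> real^'n1) \<Rightarrow> (real \<Rightarrow> real^'n2) \<Rightarrow> (real \<Rightarrow> real^'m)
    \<Rightarrow> real^'n1 \<Rightarrow> real^'n2 \<Rightarrow> real^'m \<Rightarrow> (real \<Rightarrow> real) \<Rightarrow> (real \<Rightarrow> real) \<Rightarrow> real \<Rightarrow> real" where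
  "energy f g A B b \<gamma> \<beta> t0 T x y l xs ys ls \<theta> \<eta> t =
     (pfun \<gamma> t0 t powr (2 * \<beta>)) *
       (aug_lagrangian f g A B b (x t) (y t) ls - aug_lagrangian f g A B b xs ys ls)
     + energy_part \<gamma> \<beta> t0 T \<theta> \<eta> x xs t
     + energy_part \<gamma> \<beta> t0 T \<theta> \<eta> y ys t
     + energy_part \<gamma> \<beta> t0 T \<theta> \<eta> l ls t"

end

theory Submission imports Defs begin

text \<open>The energy is nonincreasing for an explicit choice of the weights. Let \<open>q = p\<^sup>\<beta>\<close>, so that \<open>q' = \<beta> \<gamma> q\<close>, and put
\<open>\<theta> = \<beta>0 \<gamma> q\<close> and \<open>\<eta> = \<beta>0 q\<^sup>2 ((1 - \<beta>0 - 2 \<beta>) \<gamma>\<^sup>2 - \<gamma>')\<close>. When the equations of motion are inserted into the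
derivative of the energy, the mixed terms of positions and velocities vanish by the choice of \<open>\<eta>\<close>, and
the coupling of the primal variables with the multiplier cancels because \<open>\<beta>0 \<gamma> \<delta> = 1\<close>
(\<open>force_pairing\<close>). What remains is
\<open>q\<^sup>2 \<gamma> (2 \<beta> gap - \<beta>0 S) + q\<^sup>2 \<gamma> (\<beta>0 + \<beta> - 1) V + \<kappa> U\<close>. Here \<open>gap\<close> is the Lagrangian gap, \<open>S \<ge> gap \<ge> 0\<close> by convexity,
\<open>V\<close> is the squared speed, \<open>U\<close> the squared distance to the saddle point and \<open>\<kappa> = \<theta> \<theta>' + \<eta>' / 2\<close>. The first two terms are
nonpositive because \<open>2 \<beta> \<le> \<beta>0 < 1 - \<beta>\<close>.

That \<open>\<eta>\<close> is positive and \<open>\<kappa>\<close> is nonpositive rests on one property of the damping: \<open>\<gamma>' \<le> - \<beta> \<gamma>\<^sup>2\<close>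
(\<open>gamma'_le\<close>), which the differential inequality \<open>\<gamma>'' \<ge> 2 \<beta>\<^sup>2 \<gamma>\<^sup>3\<close> forces on a nonincreasing positive function that is
defined for all times.

Global existence follows. If the maximal time were finite, the energy bound would keep
positions and velocities bounded (\<open>bounded_of_energy_part\<close>). The equation is a first-order
system with a right-hand side that is continuous, and locally Lipschitz in the state uniformly for
times in a compact interval; a bounded solution of such a system extends beyond a finite end point
(\<open>ode_solution_continuation\<close>, based on \<open>picard_lindelof_local\<close>), which contradicts maximality.\<close>

section \<open>Derivatives relative to an interval\<close>

lemma at_within_tint_nontrivial:
  assumes "t \<in> tint t0 T"
  shows "at t within tint t0 T \<noteq> bot"
proof -
  obtain s where "t < s" "ereal s < T"
    using assms ereal_dense2[of "ereal t" T] by (auto simp: tint_def)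
  then have "{t..s} \<subseteq> tint t0 T"
    using assms by (auto simp: tint_def) (meson ereal_less_eq(3) le_less_trans)
  then have "at t within {t..s} \<le> at t within tint t0 T"
    by (rule at_le)
  moreover have "at t within {t..s} \<noteq> bot"
    using \<open>t < s\<close> by (simp add: at_within_Icc_at_right)
  ultimately show ?thesis
    by (metis bot.extremum_uniqueI)
qed

lemma tint_infinity: "tint t0 \<infinity> = {t0..}"
  by (auto simp: tint_def)

lemma tderiv_eqI:
  assumes "t \<in> tint t0 T" and "(u has_vector_derivative v) (at t within tint t0 T)"
  shows "tderiv (tint t0 T) u t = v"
  unfolding tderiv_def by (rule vector_derivative_within[OF at_within_tint_nontrivial[OF assms(1)] assms(2)])

lemma has_vector_derivative_tderiv:
  assumes "u differentiable_on I" and "t \<in> I"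
  shows "(u has_vector_derivative tderiv I u t) (at t within I)"
  using assms vector_derivative_works unfolding differentiable_on_def tderiv_def by blast

text \<open>The derivatives are relative to the interval, hence one-sided at an end point. The mean value
argument uses them only in the interior, where they are ordinary derivatives; the end points
are covered by continuity.\<close>

lemma antimono_on_derivative_nonpos:
  fixes u :: "real \<Rightarrow> real"
  assumes I: "is_interval I"
    and der: "\<And>t. t \<in> I \<Longrightarrow> (u has_real_derivative u' t) (at t within I)"
    and nonpos: "\<And>t. t \<in> I \<Longrightarrow> u' t \<le> 0"
  shows "antimono_on I u"
proof (rule monotone_onI)
  fix r s assume rs: "r \<in> I" "s \<in> I" "r \<le> s"
  have sub: "{r..s} \<subseteq> I"
    using mem_is_interval_1_I[OF I rs(1,2)] by auto
  show "u s \<le> u r"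
  proof (rule DERIV_nonpos_imp_decreasing_open[OF \<open>r \<le> s\<close>])
    fix t assume t: "r < t" "t < s"
    have "t \<in> I" "{r<..<s} \<subseteq> I"
      using sub t by auto
    have "(u has_real_derivative u' t) (at t within {r<..<s})"
      by (rule DERIV_subset[OF der]) fact+
    then show "\<exists>y. (u has_real_derivative y) (at t) \<and> y \<le> 0"
      using nonpos[OF \<open>t \<in> I\<close>] t by (auto simp: at_within_open[of t "{r<..<s}"])
  next
    show "continuous_on {r..s} u"
      by (rule continuous_on_subset[OF DERIV_continuous_on[OF der] sub])
  qed
qed

lemma antimono_on_imp_derivative_nonpos:
  fixes u :: "real \<Rightarrow> real"
  assumes "antimono_on I u" and "t \<in> I" and "at t within I \<noteq> bot"
    and der: "(u has_real_derivative d) (at t within I)"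
  shows "d \<le> 0"
proof (rule tendsto_upperbound)
  show "((\<lambda>s. (u s - u t) / (s - t)) \<longlongrightarrow> d) (at t within I)"
    using der by (simp add: has_field_derivative_iff)
  have "(u s - u t) / (s - t) \<le> 0" if "s \<in> I" "s \<noteq> t" for s
    using monotone_onD[OF assms(1) that(1) assms(2)] monotone_onD[OF assms(1) assms(2) that(1)] that
    by (cases "s \<le> t") (auto simp: divide_le_0_iff)
  then show "\<forall>\<^sub>F s in at t within I. (u s - u t) / (s - t) \<le> 0"
    by (auto simp: eventually_at_filter)
qed (fact assms)

lemma is_interval_tint: "is_interval (tint t0 T)"
  unfolding is_interval_1 tint_def by (metis (mono_tags, lifting) ereal_less_eq(3) le_less_trans mem_Collect_eq order_trans)

lemma C2_on_tintI:
  assumes u: "\<And>t. t \<in> tint t0 T \<Longrightarrow> (u has_vector_derivative v t) (at t within tint t0 T)"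
    and v: "\<And>t. t \<in> tint t0 T \<Longrightarrow> (v has_vector_derivative a t) (at t within tint t0 T)"
    and a: "continuous_on (tint t0 T) a"
  shows "C2_on (tint t0 T) u"
    and "t \<in> tint t0 T \<Longrightarrow> tderiv (tint t0 T) u t = v t"
    and "t \<in> tint t0 T \<Longrightarrow> tderiv (tint t0 T) (tderiv (tint t0 T) u) t = a t"
proof -
  have v_eq: "tderiv (tint t0 T) u t = v t" if "t \<in> tint t0 T" for t
    using tderiv_eqI[OF that u[OF that]] .
  have v': "(tderiv (tint t0 T) u has_vector_derivative a t) (at t within tint t0 T)"
    if "t \<in> tint t0 T" for t
    by (rule has_vector_derivative_transform[OF that _ v[OF that]]) (simp add: v_eq)
  have a_eq: "tderiv (tint t0 T) (tderiv (tint t0 T) u) t = a t" if "t \<in> tint t0 T" for t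
    using tderiv_eqI[OF that v'[OF that]] .
  show "C2_on (tint t0 T) u"
    unfolding C2_on_def differentiable_on_def
  proof (intro conjI ballI)
    show "continuous_on (tint t0 T) (tderiv (tint t0 T) (tderiv (tint t0 T) u))"
      using a by (subst continuous_on_cong[OF refl a_eq])
  qed (rule differentiableI_vector[OF u] differentiableI_vector[OF v'], assumption)+
  show "t \<in> tint t0 T \<Longrightarrow> tderiv (tint t0 T) u t = v t"
    and "t \<in> tint t0 T \<Longrightarrow> tderiv (tint t0 T) (tderiv (tint t0 T) u) t = a t"
    using v_eq a_eq by auto
qed

section \<open>Gradients of convex functions\<close>

lemma grad_GDERIV:
  fixes f :: "'a::euclidean_space \<Rightarrow> real"
  assumes "f differentiable (at x)"
  shows "GDERIV f x :> grad f x"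
proof -
  obtain f' where f': "(f has_derivative f') (at x)"
    using assms by (auto simp: differentiable_def)
  then have "linear f'" by (rule has_derivative_linear)
  have "f' = (\<lambda>h. h \<bullet> adjoint f' 1)"
    using adjoint_works[OF \<open>linear f'\<close>, of _ 1] by (simp add: fun_eq_iff)
  then have ex: "GDERIV f x :> adjoint f' 1"
    unfolding gderiv_def by (rule has_derivative_eq_rhs[OF f'])
  moreover have "D = adjoint f' 1" if "GDERIV f x :> D" for D
    using has_derivative_unique[OF that[unfolded gderiv_def] ex[unfolded gderiv_def]]
    by (metis vector_eq_ldot)
  ultimately show ?thesis
    unfolding grad_def by (rule theI)
qed

text \<open>The one-dimensional tangent inequality, applied along the segment from \<open>x\<close> to \<open>z\<close>.\<close>

lemma convex_above_tangent_plane: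
  fixes f :: "'a::real_inner \<Rightarrow> real"
  assumes convex: "convex_on UNIV f" and D: "GDERIV f x :> D"
  shows "D \<bullet> (z - x) \<le> f z - f x"
proof -
  define \<phi> where "\<phi> s = f (x + s *\<^sub>R (z - x))" for s :: real
  have "convex_on UNIV \<phi>"
  proof (rule convex_onI)
    fix \<mu> r s :: real assume "0 < \<mu>" "\<mu> < 1"
    have "x + ((1 - \<mu>) *\<^sub>R r + \<mu> *\<^sub>R s) *\<^sub>R (z - x)
        = (1 - \<mu>) *\<^sub>R (x + r *\<^sub>R (z - x)) + \<mu> *\<^sub>R (x + s *\<^sub>R (z - x))"
      by (simp add: algebra_simps)
    then show "\<phi> ((1 - \<mu>) *\<^sub>R r + \<mu> *\<^sub>R s) \<le> (1 - \<mu>) * \<phi> r + \<mu> * \<phi> s"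
      unfolding \<phi>_def using convex_onD[OF convex, of \<mu>] \<open>0 < \<mu>\<close> \<open>\<mu> < 1\<close> by simp
  qed simp
  moreover have "(\<phi> has_real_derivative D \<bullet> (z - x)) (at 0)"
  proof -
    have "((\<lambda>s. x + s *\<^sub>R (z - x)) has_derivative (\<lambda>s. s *\<^sub>R (z - x))) (at (0::real))"
      by (auto intro!: derivative_eq_intros)
    moreover have "(f has_derivative (\<lambda>h. h \<bullet> D)) (at (x + 0 *\<^sub>R (z - x)))"
      using D by (simp add: gderiv_def)
    ultimately have "(\<phi> has_derivative (\<lambda>s. (s *\<^sub>R (z - x)) \<bullet> D)) (at 0)"
      unfolding \<phi>_def by (rule has_derivative_compose)
    then show ?thesis
      by (rule has_derivative_imp_has_field_derivative) (simp add: inner_commute)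
  qed
  ultimately have "D \<bullet> (z - x) * (1 - 0) \<le> \<phi> 1 - \<phi> 0"
    by (intro convex_on_imp_above_tangent[of UNIV]) auto
  then show ?thesis by (simp add: \<phi>_def)
qed

lemma GDERIV_along_curve:
  assumes "GDERIV f (u t) :> D" and "(u has_vector_derivative v) (at t within I)"
  shows "((\<lambda>s. f (u s)) has_real_derivative D \<bullet> v) (at t within I)"
  by (rule has_derivative_imp_has_field_derivative[OF has_derivative_compose[OF
          assms(2)[unfolded has_vector_derivative_def] assms(1)[unfolded gderiv_def]]])
    (simp add: inner_commute)

section \<open>Local solutions and continuation of ordinary differential equations\<close>

text \<open>Picard--Lindelof, with values of the right-hand side controlled only on a ball around \<open>z0\<close>.
The integral operator is a contraction of the complete set of bounded continuous functions on the
real line with values in that ball: if \<open>M\<close> bounds the right-hand side, a time step of length at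
most \<open>r / M\<close> keeps the ball invariant, and a step of length at most \<open>1 / (2 (L + 1))\<close> makes the
contraction constant one half. The solution is returned in integral form because integral equations
on adjacent intervals can be joined without any discussion of one-sided derivatives.\<close>

lemma picard_lindelof_local:
  fixes F :: "real \<Rightarrow> 'a::euclidean_space \<Rightarrow> 'a"
  assumes cont: "continuous_on ({a..b} \<times> cball z0 r) (\<lambda>(t, z). F t z)"
    and lip: "\<And>t. t \<in> {a..b} \<Longrightarrow> L-lipschitz_on (cball z0 r) (F t)"
    and "a < b" and "0 < r"
  obtains c \<psi> where "a < c" and "c \<le> b" and "continuous_on {a..c} \<psi>"
    and "\<And>t. t \<in> {a..c} \<Longrightarrow> ((\<lambda>s. F s (\<psi> s)) has_integral (\<psi> t - z0)) {a..t}"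
proof -
  have "compact ((\<lambda>(t, z). F t z) ` ({a..b} \<times> cball z0 r))"
    by (intro compact_continuous_image cont compact_Times) auto
  then obtain M where "0 < M"
      and M: "\<And>t z. t \<in> {a..b} \<Longrightarrow> z \<in> cball z0 r \<Longrightarrow> norm (F t z) \<le> M"
    by (auto simp: bounded_pos dest!: compact_imp_bounded)
  have "0 \<le> L"
    using lip[of a] \<open>a < b\<close> lipschitz_on_nonneg by force
  define c where "c = min b (a + min (r / M) (1 / (2 * (L + 1))))"
  have c: "a < c" "c \<le> b" "c - a \<le> r / M" "c - a \<le> 1 / (2 * (L + 1))"
    using \<open>a < b\<close> \<open>0 < r\<close> \<open>0 < M\<close> \<open>0 \<le> L\<close> by (auto simp: c_def)
  have cM: "(c - a) * M \<le> r"
    using c(3) \<open>0 < M\<close> by (simp add: field_simps)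
  have cL: "(c - a) * L \<le> 1 / 2"
  proof -
    have "(c - a) * L \<le> 1 / (2 * (L + 1)) * L"
      using c \<open>0 \<le> L\<close> by (intro mult_right_mono) auto
    also have "\<dots> \<le> 1 / 2"
      using \<open>0 \<le> L\<close> by (simp add: field_simps)
    finally show ?thesis .
  qed
  define S :: "(real \<Rightarrow>\<^sub>C 'a) set" where "S = PiC UNIV (\<lambda>_. cball z0 r)"
  have S: "\<phi> \<in> S \<longleftrightarrow> (\<forall>t. apply_bcontfun \<phi> t \<in> cball z0 r)" for \<phi>
    by (auto simp: S_def mem_PiC_iff)
  \<comment> \<open>Freezing time outside the interval lets the operator act on functions on the whole real line.\<close>
  define cl where "cl t = max a (min c t)" for t
  have cl: "cl t \<in> {a..c}" for t
    using c by (auto simp: cl_def)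
  have cont_cl: "continuous_on UNIV cl"
    unfolding cl_def by (intro continuous_intros)
  define J where "J \<phi> t = z0 + integral {a..cl t} (\<lambda>s. F s (apply_bcontfun \<phi> s))" for \<phi> t
  have contF: "continuous_on {a..c} (\<lambda>s. F s (apply_bcontfun \<phi> s))" if "\<phi> \<in> S" for \<phi>
  proof -
    have "continuous_on {a..c} ((\<lambda>(t, z). F t z) \<circ> (\<lambda>s. (s, apply_bcontfun \<phi> s)))"
      using that c by (intro continuous_on_compose continuous_on_subset[OF cont] continuous_intros) (auto simp: S)
    then show ?thesis by (simp add: o_def)
  qed
  have intF: "(\<lambda>s. F s (apply_bcontfun \<phi> s)) integrable_on {a..cl t}" if "\<phi> \<in> S" for \<phi> t
    using cl[of t] by (intro integrable_continuous_real continuous_on_subset[OF contF[OF that]]) auto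
  have J_ball: "J \<phi> t \<in> cball z0 r" if "\<phi> \<in> S" for \<phi> t
  proof -
    have "norm (integral {a..cl t} (\<lambda>s. F s (apply_bcontfun \<phi> s))) \<le> M * (cl t - a)"
      using cl[of t] c that
      by (intro integral_bound continuous_on_subset[OF contF[OF that]] M) (auto simp: S)
    also have "\<dots> \<le> (c - a) * M"
      using cl[of t] \<open>0 < M\<close> by simp
    finally show ?thesis using cM by (simp add: J_def dist_norm)
  qed
  have J_bcont: "J \<phi> \<in> bcontfun" if "\<phi> \<in> S" for \<phi>
  proof -
    have "continuous_on {a..c} (\<lambda>t. integral {a..t} (\<lambda>s. F s (apply_bcontfun \<phi> s)))"
      by (intro indefinite_integral_continuous_1 integrable_continuous_real contF that)
    then have "continuous_on UNIV (\<lambda>t. integral {a..cl t} (\<lambda>s. F s (apply_bcontfun \<phi> s)))"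
      using continuous_on_compose2[OF _ cont_cl] cl by blast
    then have "continuous_on UNIV (J \<phi>)"
      unfolding J_def by (intro continuous_intros)
    moreover have "bounded (range (J \<phi>))"
      by (rule bounded_subset[OF bounded_cball]) (use J_ball[OF that] in blast)
    ultimately show ?thesis by (simp add: bcontfun_def)
  qed
  define P where "P \<phi> = Bcontfun (J \<phi>)" for \<phi>
  have P: "apply_bcontfun (P \<phi>) = J \<phi>" if "\<phi> \<in> S" for \<phi>
    unfolding P_def by (rule Bcontfun_inverse[OF J_bcont[OF that]])
  have contraction: "dist (P \<phi>) (P \<psi>) \<le> 1 / 2 * dist \<phi> \<psi>" if "\<phi> \<in> S" "\<psi> \<in> S" for \<phi> \<psi>
  proof (rule dist_bound)
    fix t
    have "dist (P \<phi> t) (P \<psi> t)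
        = norm (integral {a..cl t} (\<lambda>s. F s (apply_bcontfun \<phi> s) - F s (apply_bcontfun \<psi> s)))"
      using that by (simp add: P J_def dist_norm integral_diff intF)
    also have "\<dots> \<le> (L * dist \<phi> \<psi>) * (cl t - a)"
    proof (intro integral_bound)
      show "a \<le> cl t" using cl by auto
      show "continuous_on {a..cl t} (\<lambda>s. F s (apply_bcontfun \<phi> s) - F s (apply_bcontfun \<psi> s))"
        using cl[of t] that by (intro continuous_intros continuous_on_subset[OF contF]) auto
      fix s assume "s \<in> {a..cl t}"
      then have "s \<in> {a..b}" using cl[of t] c by auto
      then have "norm (F s (\<phi> s) - F s (\<psi> s)) \<le> L * dist (\<phi> s) (\<psi> s)"
        using lipschitz_onD[OF lip] that by (simp add: S dist_norm)
      also have "\<dots> \<le> L * dist \<phi> \<psi>"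
        using \<open>0 \<le> L\<close> by (intro mult_left_mono dist_bounded)
      finally show "norm (F s (\<phi> s) - F s (\<psi> s)) \<le> L * dist \<phi> \<psi>" .
    qed
    also have "\<dots> \<le> (L * dist \<phi> \<psi>) * (c - a)"
      using cl[of t] \<open>0 \<le> L\<close> by (intro mult_left_mono) auto
    also have "\<dots> = ((c - a) * L) * dist \<phi> \<psi>"
      by simp
    also have "\<dots> \<le> 1 / 2 * dist \<phi> \<psi>"
      using cL by (intro mult_right_mono) auto
    finally show "dist (P \<phi> t) (P \<psi> t) \<le> 1 / 2 * dist \<phi> \<psi>" .
  qed
  have "complete S"
    unfolding S_def complete_eq_closed by (intro closed_PiC) auto
  moreover have "const_bcontfun z0 \<in> S"
    using \<open>0 < r\<close> by (simp add: S const_bcontfun.rep_eq)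
  moreover have "P ` S \<subseteq> S"
    using J_ball by (auto simp: S P)
  ultimately have "\<exists>!\<phi>\<in>S. P \<phi> = \<phi>"
    using contraction by (intro Banach_fix[where c = "1/2"]) auto
  then obtain \<phi> where \<phi>: "\<phi> \<in> S" "P \<phi> = \<phi>" by blast
  show thesis
  proof (rule that[of c "apply_bcontfun \<phi>"])
    fix t assume "t \<in> {a..c}"
    then have "cl t = t" by (auto simp: cl_def)
    then have "\<phi> t - z0 = integral {a..t} (\<lambda>s. F s (\<phi> s))"
      using fun_cong[OF P[OF \<phi>(1)], of t] unfolding \<phi>(2) by (simp add: J_def)
    then show "((\<lambda>s. F s (\<phi> s)) has_integral (\<phi> t - z0)) {a..t}"
      using intF[OF \<phi>(1), of t] \<open>cl t = t\<close> by (simp add: has_integral_integrable_integral)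
  qed (use c in auto)
qed

text \<open>A bounded solution on a bounded half-open interval does not stop there. On the compact set that
the solution stays in, the right-hand side is bounded, so the solution is Lipschitz and has a limit
at \<open>T\<close>. Starting a local solution from this limit and joining the two integral equations gives a
continuous function that solves the integral equation beyond \<open>T\<close>; differentiating the integral
shows that it solves the differential equation, also at the junction.\<close>

lemma ode_solution_continuation:
  fixes F :: "real \<Rightarrow> 'a::euclidean_space \<Rightarrow> 'a"
  assumes "t0 < T"
    and cont: "continuous_on ({t0..} \<times> UNIV) (\<lambda>(t, z). F t z)"
    and lip: "\<And>b z. \<exists>r>0. \<exists>L. \<forall>t\<in>{t0..b}. L-lipschitz_on (cball z r) (F t)"
    and z: "\<And>t. t \<in> {t0..<T} \<Longrightarrow> (z has_vector_derivative F t (z t)) (at t within {t0..<T})"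
    and bdd: "bounded (z ` {t0..<T})"
  obtains c Z where "T < c" and "\<And>t. t \<in> {t0..<T} \<Longrightarrow> Z t = z t"
    and "\<And>t. t \<in> {t0..<c} \<Longrightarrow> (Z has_vector_derivative F t (Z t)) (at t within {t0..<c})"
proof -
  obtain R where R: "\<And>t. t \<in> {t0..<T} \<Longrightarrow> z t \<in> cball 0 R"
    using bdd unfolding bounded_iff by (metis imageI mem_cball_0)
  have "compact ((\<lambda>(t, z). F t z) ` ({t0..T} \<times> cball 0 R))"
    by (intro compact_continuous_image continuous_on_subset[OF cont] compact_Times) auto
  then obtain M where "0 < M"
      and M: "\<And>t w. t \<in> {t0..T} \<Longrightarrow> w \<in> cball 0 R \<Longrightarrow> norm (F t w) \<le> M"
    by (auto simp: bounded_pos dest!: compact_imp_bounded)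
  have "M-lipschitz_on {t0..<T} z"
  proof (rule bounded_derivative_imp_lipschitz)
    fix t assume t: "t \<in> {t0..<T}"
    show "(z has_derivative (\<lambda>h. h *\<^sub>R F t (z t))) (at t within {t0..<T})"
      using z[OF t] by (simp add: has_vector_derivative_def)
    show "onorm (\<lambda>h. h *\<^sub>R F t (z t)) \<le> M"
      using M[of t "z t"] R[OF t] t by (intro onorm_le) (auto simp: mult.commute[of M] intro!: mult_left_mono)
  qed (use \<open>0 < M\<close> in auto)
  then have "uniformly_continuous_on {t0..<T} z"
    by (rule lipschitz_on_uniformly_continuous)
  then obtain w where w: "uniformly_continuous_on (closure {t0..<T}) w"
      and wz: "\<And>t. t \<in> {t0..<T} \<Longrightarrow> z t = w t"
    by (rule uniformly_continuous_on_extension_on_closure) blast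
  have contw: "continuous_on {t0..T} w"
    using w \<open>t0 < T\<close> by (simp add: uniformly_continuous_imp_continuous)
  have intw: "((\<lambda>s. F s (w s)) has_integral (w t - w t0)) {t0..t}" if "t \<in> {t0..T}" for t
  proof (rule fundamental_theorem_of_calculus_interior)
    fix s assume s: "s \<in> {t0<..<t}"
    then have "(z has_vector_derivative F s (z s)) (at s within {t0<..<T})"
      using z[of s] that by (auto intro: has_vector_derivative_within_subset)
    then have "(z has_vector_derivative F s (z s)) (at s)"
      using s that by (simp add: at_within_open[of s "{t0<..<T}"])
    then have "(w has_vector_derivative F s (z s)) (at s)"
      by (rule has_vector_derivative_transform_within_open[of _ _ _ "{t0<..<T}"])
        (use s that wz in auto)
    then show "(w has_vector_derivative F s (w s)) (at s)"
      using wz[of s] s that by simp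
  qed (use that continuous_on_subset[OF contw] in auto)
  obtain r L where "0 < r" and L: "\<And>t. t \<in> {t0..T + 1} \<Longrightarrow> L-lipschitz_on (cball (w T) r) (F t)"
    using lip[of "T + 1" "w T"] by blast
  obtain c \<psi> where c: "T < c" "c \<le> T + 1" and cont\<psi>: "continuous_on {T..c} \<psi>"
      and int\<psi>: "\<And>t. t \<in> {T..c} \<Longrightarrow> ((\<lambda>s. F s (\<psi> s)) has_integral (\<psi> t - w T)) {T..t}"
  proof (rule picard_lindelof_local[of T "T + 1" "w T" r F L])
    show "continuous_on ({T..T + 1} \<times> cball (w T) r) (\<lambda>(t, z). F t z)"
      using \<open>t0 < T\<close> by (intro continuous_on_subset[OF cont]) auto
  qed (use \<open>0 < r\<close> \<open>t0 < T\<close> L in auto)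
  have "\<psi> T = w T"
    using has_integral_unique[OF int\<psi>[of T], of 0] c by (simp add: has_integral_refl)
  define Z where "Z t = (if t \<le> T then w t else \<psi> t)" for t
  have "continuous_on ({t0..T} \<union> {T..c}) Z"
    unfolding Z_def
    by (rule continuous_on_If) (use contw cont\<psi> \<open>\<psi> T = w T\<close> in auto)
  moreover have "{t0..T} \<union> {T..c} = {t0..c}"
    using \<open>t0 < T\<close> c by auto
  ultimately have contZ: "continuous_on {t0..c} Z" by simp
  have Zw: "Z s = w s" if "s \<in> {t0..T}" for s
    using that by (simp add: Z_def)
  have Z\<psi>: "Z s = \<psi> s" if "s \<in> {T..c}" for s
    using that \<open>\<psi> T = w T\<close> by (auto simp: Z_def)
  have intZ: "((\<lambda>s. F s (Z s)) has_integral (Z t - Z t0)) {t0..t}" if t: "t \<in> {t0..c}" for t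
  proof (cases "t \<le> T")
    case True
    have "((\<lambda>s. F s (Z s)) has_integral (w t - w t0)) {t0..t}"
      by (rule has_integral_eq[OF _ intw]) (use True t Zw in auto)
    then show ?thesis using Zw True t by simp
  next
    case False
    have "((\<lambda>s. F s (Z s)) has_integral (w T - w t0)) {t0..T}"
      by (rule has_integral_eq[OF _ intw]) (use \<open>t0 < T\<close> Zw in auto)
    moreover have "((\<lambda>s. F s (Z s)) has_integral (\<psi> t - w T)) {T..t}"
      by (rule has_integral_eq[OF _ int\<psi>]) (use False t Z\<psi> in auto)
    ultimately have "((\<lambda>s. F s (Z s)) has_integral (w T - w t0 + (\<psi> t - w T))) {t0..t}"
      using False \<open>t0 < T\<close> by (intro has_integral_combine[of t0 T t]) auto
    then show ?thesis using Zw[of t0] Z\<psi>[of t] False t \<open>t0 < T\<close> by simp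
  qed
  have "continuous_on {t0..c} ((\<lambda>(t, z). F t z) \<circ> (\<lambda>s. (s, Z s)))"
    by (intro continuous_on_compose continuous_on_subset[OF cont] continuous_intros contZ) auto
  then have contFZ: "continuous_on {t0..c} (\<lambda>s. F s (Z s))" by (simp add: o_def)
  show thesis
  proof (rule that[of c Z])
    fix t assume t: "t \<in> {t0..<c}"
    have "((\<lambda>u. Z t0 + integral {t0..u} (\<lambda>s. F s (Z s))) has_vector_derivative F t (Z t))
        (at t within {t0..c})"
      using integral_has_vector_derivative[OF contFZ, of t] t
      by (auto intro!: derivative_eq_intros)
    then have "(Z has_vector_derivative F t (Z t)) (at t within {t0..c})"
      by (rule has_vector_derivative_transform[rotated 2])
        (use t integral_unique[OF intZ] in auto)
    then show "(Z has_vector_derivative F t (Z t)) (at t within {t0..<c})"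
      by (rule has_vector_derivative_within_subset) auto
  qed (use c Zw wz in auto)
qed

section \<open>The damping coefficient and the energy weights\<close>

locale vanishing_damping =
  fixes \<gamma> :: "real \<Rightarrow> real" and \<beta> t0 :: real
  assumes gamma_pos: "t0 \<le> t \<Longrightarrow> 0 < \<gamma> t"
    and gamma_antimono: "antimono_on {t0..} \<gamma>"
    and gamma_C2: "C2_on {t0..} \<gamma>"
    and beta_pos: "0 < \<beta>" and beta_less: "\<beta> < 1 / 3"
    and gamma_convex: "t0 \<le> t \<Longrightarrow> 2 * \<beta>\<^sup>2 * \<gamma> t ^ 3 \<le> tderiv {t0..} (tderiv {t0..} \<gamma>) t"
begin

abbreviation \<gamma>' where "\<gamma>' \<equiv> tderiv {t0..} \<gamma>"
abbreviation \<gamma>'' where "\<gamma>'' \<equiv> tderiv {t0..} \<gamma>'"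

lemma gamma_derivative: "t0 \<le> t \<Longrightarrow> (\<gamma> has_real_derivative \<gamma>' t) (at t within {t0..})"
  and gamma'_derivative: "t0 \<le> t \<Longrightarrow> (\<gamma>' has_real_derivative \<gamma>'' t) (at t within {t0..})"
  using gamma_C2 has_vector_derivative_tderiv[of \<gamma> "{t0..}" t] has_vector_derivative_tderiv[of \<gamma>' "{t0..}" t]
  by (auto simp: C2_on_def has_real_derivative_iff_has_vector_derivative)

lemma gamma'_nonpos:
  assumes "t0 \<le> t"
  shows "\<gamma>' t \<le> 0"
  using antimono_on_imp_derivative_nonpos[OF gamma_antimono _ _ gamma_derivative[OF assms]]
    at_within_tint_nontrivial[of t t0 \<infinity>] assms by (simp add: tint_infinity)

text \<open>This is the Riccati-type bound hidden in the convexity condition on \<open>\<gamma>\<close>. Multiplying the condition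
by \<open>2 \<gamma>' \<le> 0\<close> shows that \<open>W = \<gamma>'\<^sup>2 - \<beta>\<^sup>2 \<gamma>\<^sup>4\<close> is nonincreasing. If the bound failed at some time, then \<open>W\<close>
would be negative from then on, which keeps \<open>\<gamma>\<close> above a positive level, hence \<open>\<gamma>''\<close> above a
positive constant, and \<open>\<gamma>'\<close> would eventually become positive.\<close>

lemma gamma'_le:
  assumes "t0 \<le> t"
  shows "\<gamma>' t \<le> - \<beta> * (\<gamma> t)\<^sup>2"
proof (rule ccontr)
  assume "\<not> ?thesis"
  then have less: "- \<gamma>' t < \<beta> * (\<gamma> t)\<^sup>2" by simp
  define W where "W s = (\<gamma>' s)\<^sup>2 - \<beta>\<^sup>2 * \<gamma> s ^ 4" for s
  have "antimono_on {t0..} W"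
  proof (rule antimono_on_derivative_nonpos)
    fix s assume s: "s \<in> {t0..}"
    show "(W has_real_derivative 2 * \<gamma>' s * (\<gamma>'' s - 2 * \<beta>\<^sup>2 * \<gamma> s ^ 3)) (at s within {t0..})"
      unfolding W_def using gamma_derivative[of s] gamma'_derivative[of s] s
      by (auto intro!: derivative_eq_intros simp: algebra_simps)
    show "2 * \<gamma>' s * (\<gamma>'' s - 2 * \<beta>\<^sup>2 * \<gamma> s ^ 3) \<le> 0"
      using gamma'_nonpos[of s] gamma_convex[of s] s by (auto simp: mult_le_0_iff)
  qed (simp add: is_interval_ci)
  then have W_le: "W s \<le> W t" if "t \<le> s" for s
    using monotone_onD[OF \<open>antimono_on {t0..} W\<close>, of t s] that assms by simp
  have "(- \<gamma>' t)\<^sup>2 < (\<beta> * (\<gamma> t)\<^sup>2)\<^sup>2"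
    using less gamma'_nonpos[OF assms] by (intro power_strict_mono) auto
  then have "W t < 0"
    by (simp add: W_def power_mult_distrib)
  \<comment> \<open>The level below which \<open>W s \<le> W t\<close> does not let \<open>\<gamma> s\<close> drop.\<close>
  define d where "d = root 4 (- W t / \<beta>\<^sup>2)"
  have "0 < - W t / \<beta>\<^sup>2"
    using \<open>W t < 0\<close> beta_pos by (simp add: divide_neg_pos)
  have "0 < d"
    unfolding d_def using \<open>0 < - W t / \<beta>\<^sup>2\<close> by (intro real_root_gt_zero) auto
  have "d ^ 4 = - W t / \<beta>\<^sup>2"
    unfolding d_def using \<open>0 < - W t / \<beta>\<^sup>2\<close> by (intro real_root_pow_pos) auto
  then have d4: "\<beta>\<^sup>2 * d ^ 4 = - W t"
    using beta_pos by simp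
  have d_le: "d \<le> \<gamma> s" if "t \<le> s" for s
  proof -
    have "\<beta>\<^sup>2 * d ^ 4 \<le> \<beta>\<^sup>2 * \<gamma> s ^ 4"
      using W_le[OF that] d4 unfolding W_def[of s]
      by (smt (verit) zero_le_power2)
    then have "d ^ 4 \<le> \<gamma> s ^ 4"
      using beta_pos by simp
    then show ?thesis
      using gamma_pos[of s] that assms power_mono_iff[of d "\<gamma> s" 4] \<open>0 < d\<close> by simp
  qed
  define k where "k = 2 * \<beta>\<^sup>2 * d ^ 3"
  have "0 < k"
    using \<open>0 < d\<close> beta_pos by (simp add: k_def)
  have mono: "antimono_on {t..} (\<lambda>s. k * s - \<gamma>' s)"
  proof (rule antimono_on_derivative_nonpos)
    fix s assume s: "s \<in> {t..}"
    have "(\<gamma>' has_real_derivative \<gamma>'' s) (at s within {t..})"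
      by (rule DERIV_subset[OF gamma'_derivative]) (use s assms in auto)
    then show "((\<lambda>s. k * s - \<gamma>' s) has_real_derivative k - \<gamma>'' s) (at s within {t..})"
      by (auto intro!: derivative_eq_intros)
    have "k \<le> 2 * \<beta>\<^sup>2 * \<gamma> s ^ 3"
      unfolding k_def using d_le[of s] s \<open>0 < d\<close>
      by (intro mult_left_mono power_mono) auto
    then show "k - \<gamma>'' s \<le> 0"
      using gamma_convex[of s] s assms by simp
  qed (simp add: is_interval_ci)
  \<comment> \<open>A time at which the growth at rate \<open>k\<close> has brought \<open>\<gamma>'\<close> up to at least one.\<close>
  define s where "s = t + (1 - \<gamma>' t) / k"
  have "t \<le> s"
    using \<open>0 < k\<close> gamma'_nonpos[OF assms] by (simp add: s_def)
  then have "k * s - \<gamma>' s \<le> k * t - \<gamma>' t"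
    using monotone_onD[OF mono, of t s] by simp
  moreover have "k * s = k * t + 1 - \<gamma>' t"
    using \<open>0 < k\<close> by (simp add: s_def field_simps)
  ultimately show False
    using gamma'_nonpos[of s] \<open>t \<le> s\<close> assms by simp
qed

definition q where "q t = pfun \<gamma> t0 t powr \<beta>"

lemma gamma_continuous: "continuous_on {t0..} \<gamma>"
  by (rule DERIV_continuous_on[OF gamma_derivative]) simp

lemma gamma'_continuous: "continuous_on {t0..} \<gamma>'"
  by (rule DERIV_continuous_on[OF gamma'_derivative]) simp

lemma q_eq_exp: "q t = exp (\<beta> * integral {t0..t} \<gamma>)"
  by (simp add: q_def pfun_def powr_def)

lemma q_square: "pfun \<gamma> t0 t powr (2 * \<beta>) = (q t)\<^sup>2"
  unfolding q_def power2_eq_square powr_add[symmetric] mult_2 ..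

lemma q_ge_1: "1 \<le> q t"
proof -
  have "\<gamma> integrable_on {t0..t}"
    by (intro integrable_continuous_real continuous_on_subset[OF gamma_continuous]) auto
  then have "0 \<le> integral {t0..t} \<gamma>"
    using gamma_pos by (intro integral_nonneg) (auto intro: less_imp_le)
  then show ?thesis
    using beta_pos by (simp add: q_eq_exp)
qed

lemma q_derivative:
  assumes "t0 \<le> t"
  shows "(q has_real_derivative \<beta> * \<gamma> t * q t) (at t within {t0..})"
proof -
  have "((\<lambda>u. integral {t0..u} \<gamma>) has_vector_derivative \<gamma> t) (at t within {t0..t + 1})"
    using assms by (intro integral_has_vector_derivative continuous_on_subset[OF gamma_continuous]) auto
  moreover have "at t within {t0..t + 1} = at t within {t0..}"
    by (rule at_within_nhd[where S = "{..<t + 1}"]) auto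
  ultimately have "((\<lambda>u. integral {t0..u} \<gamma>) has_real_derivative \<gamma> t) (at t within {t0..})"
    by (simp add: has_real_derivative_iff_has_vector_derivative)
  then show ?thesis
    unfolding q_eq_exp[abs_def] by (auto intro!: derivative_eq_intros)
qed

end

text \<open>The weights come from requiring that the derivative of the energy contain no terms of indefinite
sign. The terms coming from the coupling of primal and dual variables cancel exactly when
\<open>\<theta> \<delta> = q\<close>, that is \<open>\<theta> = \<beta>0 \<gamma> q\<close> with \<open>q = p\<^sup>\<beta>\<close>; and the mixed term \<open>(u - us) \<bullet> u'\<close> disappears exactly when
\<open>\<eta> = \<theta> ((1 - \<beta>) \<gamma> q - \<theta>) - q \<theta>'\<close>, which is the formula below with \<open>\<theta>'\<close> computed. The function \<open>\<kappa>\<close> is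
\<open>\<theta> \<theta>' + \<eta>' / 2\<close>, the coefficient that is then left in front of the squared distance to the reference point.\<close>

locale energy_weights = vanishing_damping +
  fixes \<beta>0 :: real
  assumes beta0_ge: "2 * \<beta> \<le> \<beta>0" and beta0_less: "\<beta>0 < 1 - \<beta>"
begin

definition \<theta> where "\<theta> t = \<beta>0 * \<gamma> t * q t"
definition \<eta> where "\<eta> t = \<beta>0 * (q t)\<^sup>2 * ((1 - \<beta>0 - 2 * \<beta>) * (\<gamma> t)\<^sup>2 - \<gamma>' t)"

definition \<kappa> where
  "\<kappa> t = \<beta>0 / 2 * (q t)\<^sup>2 * ((2 - 6 * \<beta>) * (\<gamma> t * \<gamma>' t) + (2 * \<beta> - 4 * \<beta>\<^sup>2) * \<gamma> t ^ 3 - \<gamma>'' t)"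

lemma theta_pos: "t0 \<le> t \<Longrightarrow> 0 < \<theta> t"
  using gamma_pos[of t] q_ge_1[of t] beta_pos beta0_ge by (simp add: \<theta>_def)

text \<open>The factor \<open>1 - \<beta>0 - 2 \<beta>\<close> can be negative, but only by less than \<open>\<beta>\<close>; the bound on \<open>\<gamma>'\<close> supplies
the missing \<open>\<beta> \<gamma>\<^sup>2\<close>.\<close>

lemma eta_pos:
  assumes "t0 \<le> t"
  shows "0 < \<eta> t"
proof -
  have "0 < (1 - \<beta>0 - \<beta>) * (\<gamma> t)\<^sup>2"
    using beta0_less gamma_pos[OF assms] by simp
  also have "\<dots> \<le> (1 - \<beta>0 - 2 * \<beta>) * (\<gamma> t)\<^sup>2 - \<gamma>' t"
    using gamma'_le[OF assms] by (simp add: algebra_simps)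
  finally show ?thesis
    using q_ge_1[of t] beta_pos beta0_ge by (simp add: \<eta>_def)
qed

text \<open>Here \<open>\<beta> < 1/3\<close> enters: it makes the factor of \<open>\<gamma> \<gamma>'\<close> positive, so that the bound on \<open>\<gamma>'\<close> can be
inserted. What remains is exactly \<open>2 \<beta>\<^sup>2 \<gamma>\<^sup>3 - \<gamma>''\<close>, which the condition on \<open>\<gamma>''\<close> makes nonpositive.\<close>

lemma kappa_nonpos:
  assumes "t0 \<le> t"
  shows "\<kappa> t \<le> 0"
proof -
  have "\<gamma> t * \<gamma>' t \<le> \<gamma> t * (- \<beta> * (\<gamma> t)\<^sup>2)"
    using gamma_pos[OF assms] by (intro mult_left_mono[OF gamma'_le[OF assms]]) simp
  then have "(2 - 6 * \<beta>) * (\<gamma> t * \<gamma>' t) \<le> (2 - 6 * \<beta>) * (\<gamma> t * (- \<beta> * (\<gamma> t)\<^sup>2))"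
    by (rule mult_left_mono) (use beta_less in simp)
  also have "\<dots> = 2 * \<beta>\<^sup>2 * \<gamma> t ^ 3 - (2 * \<beta> - 4 * \<beta>\<^sup>2) * \<gamma> t ^ 3"
    by (simp add: algebra_simps power2_eq_square power3_eq_cube)
  finally show ?thesis
    unfolding \<kappa>_def using gamma_convex[OF assms] beta_pos beta0_ge
    by (intro mult_nonneg_nonpos) auto
qed

lemma theta_continuous: "continuous_on {t0..} \<theta>"
  and eta_continuous: "continuous_on {t0..} \<eta>"
proof -
  have "continuous_on {t0..} q"
    by (rule DERIV_continuous_on[OF q_derivative]) simp
  then show "continuous_on {t0..} \<theta>" "continuous_on {t0..} \<eta>"
    unfolding \<theta>_def \<eta>_def
    by (intro continuous_intros gamma_continuous gamma'_continuous; assumption)+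
qed

text \<open>One lemma serves the three blocks of variables: \<open>F\<close> is the force on the block, that is, the
right-hand side of its second-order equation. Only the pairing with \<open>F\<close> sees the
other blocks.\<close>

lemma energy_part_derivative:
  fixes u :: "real \<Rightarrow> 'a::real_inner"
  assumes I_def: "I = tint t0 T" and t: "t \<in> I"
    and u: "(u has_vector_derivative tderiv I u t) (at t within I)"
    and v: "(tderiv I u has_vector_derivative F - \<gamma> t *\<^sub>R tderiv I u t) (at t within I)"
  shows "(energy_part \<gamma> \<beta> t0 T \<theta> \<eta> u us has_real_derivative
      (q t)\<^sup>2 * \<gamma> t * (\<beta>0 + \<beta> - 1) * (norm (tderiv I u t))\<^sup>2 + \<kappa> t * (norm (u t - us))\<^sup>2
      + (q t)\<^sup>2 * (((\<beta>0 * \<gamma> t) *\<^sub>R (u t - us) + tderiv I u t) \<bullet> F)) (at t within I)"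
    (is "(_ has_real_derivative ?D) _")
proof -
  have "t0 \<le> t" and I: "I \<subseteq> {t0..}"
    using t by (auto simp: I_def tint_def)
  define d where "d s = u s - us" for s
  define v where "v = tderiv I u"
  define w where "w s = \<theta> s *\<^sub>R d s + q s *\<^sub>R v s" for s
  define \<theta>' where "\<theta>' = \<beta>0 * \<gamma>' t * q t + \<beta>0 * \<gamma> t * (\<beta> * \<gamma> t * q t)"
  define \<eta>' where "\<eta>' = 2 * \<beta> * \<beta>0 * \<gamma> t * (q t)\<^sup>2 * ((1 - \<beta>0 - 2 * \<beta>) * (\<gamma> t)\<^sup>2 - \<gamma>' t)
      + \<beta>0 * (q t)\<^sup>2 * (2 * (1 - \<beta>0 - 2 * \<beta>) * \<gamma> t * \<gamma>' t - \<gamma>'' t)"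
  note base = DERIV_subset[OF gamma_derivative[OF \<open>t0 \<le> t\<close>] I]
    DERIV_subset[OF gamma'_derivative[OF \<open>t0 \<le> t\<close>] I] DERIV_subset[OF q_derivative[OF \<open>t0 \<le> t\<close>] I]
  have \<theta>': "(\<theta> has_real_derivative \<theta>') (at t within I)"
    unfolding \<theta>_def \<theta>'_def using base by (auto intro!: derivative_eq_intros simp: algebra_simps)
  have \<eta>': "(\<eta> has_real_derivative \<eta>') (at t within I)"
    unfolding \<eta>_def \<eta>'_def using base
    by (auto intro!: derivative_eq_intros simp: algebra_simps power2_eq_square)
  have d': "(d has_vector_derivative v t) (at t within I)"
    unfolding d_def v_def using u by (auto intro!: derivative_eq_intros)
  define w' where "w' = \<theta> t *\<^sub>R v t + \<theta>' *\<^sub>R d t + (q t *\<^sub>R (F - \<gamma> t *\<^sub>R v t) + (\<beta> * \<gamma> t * q t) *\<^sub>R v t)"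
  have w': "(w has_vector_derivative w') (at t within I)"
    unfolding w_def w'_def using v[folded v_def] d' \<theta>' base(3)
    by (intro has_vector_derivative_add has_vector_derivative_scaleR)
  note inner' = bounded_bilinear.has_vector_derivative[OF bounded_bilinear_inner]
  have "((\<lambda>s. 1/2 * (w s \<bullet> w s) + \<eta> s / 2 * (d s \<bullet> d s)) has_real_derivative
      w t \<bullet> w' + (\<eta>' / 2 * (d t \<bullet> d t) + \<eta> t * (d t \<bullet> v t))) (at t within I)"
    using inner'[OF w' w'] inner'[OF d' d'] \<eta>'
    unfolding has_real_derivative_iff_has_vector_derivative[symmetric]
    by (auto intro!: derivative_eq_intros simp: inner_commute field_simps)
  also have "(\<lambda>s. 1/2 * (w s \<bullet> w s) + \<eta> s / 2 * (d s \<bullet> d s)) = energy_part \<gamma> \<beta> t0 T \<theta> \<eta> u us"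
    by (simp add: fun_eq_iff energy_part_def w_def d_def v_def I_def q_def power2_norm_eq_inner)
  also have "w t \<bullet> w' + (\<eta>' / 2 * (d t \<bullet> d t) + \<eta> t * (d t \<bullet> v t)) = ?D"
  proof -
    define dd dv vv dF vF where *: "dd = d t \<bullet> d t" "dv = d t \<bullet> v t" "vv = v t \<bullet> v t"
        "dF = d t \<bullet> F" "vF = v t \<bullet> F"
    have 1: "w t \<bullet> w' = \<theta> t * (\<theta> t * dv + \<theta>' * dd + (q t * (dF - \<gamma> t * dv) + \<beta> * \<gamma> t * q t * dv))
        + q t * (\<theta> t * vv + \<theta>' * dv + (q t * (vF - \<gamma> t * vv) + \<beta> * \<gamma> t * q t * vv))"
      by (simp add: w_def w'_def inner_simps * inner_commute[of "v t" "d t"] algebra_simps)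
    have 2: "?D = (q t)\<^sup>2 * \<gamma> t * (\<beta>0 + \<beta> - 1) * vv + \<kappa> t * dd + (q t)\<^sup>2 * (\<beta>0 * \<gamma> t * dF + vF)"
      by (simp add: * power2_norm_eq_inner inner_simps flip: d_def v_def)
    show ?thesis
      unfolding 1 2 unfolding *(1,2)[symmetric] \<theta>_def \<eta>_def \<kappa>_def \<theta>'_def \<eta>'_def
      by (simp add: field_simps power2_eq_square power3_eq_cube)
  qed
  finally show ?thesis .
qed

end

section \<open>Decay of the energy along a trajectory\<close>

locale saddle_trajectory = energy_weights \<gamma> \<beta> t0 \<beta>0
  for \<gamma> :: "real \<Rightarrow> real" and \<beta> t0 \<beta>0 :: real +
  fixes f :: "real^'n1 \<Rightarrow> real" and g :: "real^'n2 \<Rightarrow> real"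
    and A :: "real^'n1^'m" and B :: "real^'n2^'m" and b :: "real^'m"
    and \<delta> :: "real \<Rightarrow> real" and T :: ereal
    and x :: "real \<Rightarrow> real^'n1" and y :: "real \<Rightarrow> real^'n2" and l :: "real \<Rightarrow> real^'m"
    and xs :: "real^'n1" and ys :: "real^'n2" and ls :: "real^'m"
  assumes f_convex: "convex_on UNIV f" and f_cont_diff: "cont_diff f"
    and g_convex: "convex_on UNIV g" and g_cont_diff: "cont_diff g"
    and delta: "t0 \<le> t \<Longrightarrow> \<delta> t = 1 / (\<beta>0 * \<gamma> t)"
    and saddle: "(xs, ys, ls) \<in> Omega f g A B b"
    and solution: "solution_S f g A B b \<gamma> \<delta> t0 T x y l"
begin

abbreviation I where "I \<equiv> tint t0 T"
abbreviation x' where "x' \<equiv> tderiv I x"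
abbreviation y' where "y' \<equiv> tderiv I y"
abbreviation l' where "l' \<equiv> tderiv I l"

definition r where "r t = A *v x t + B *v y t - b"
definition r' where "r' t = A *v x' t + B *v y' t"
definition gap where "gap t = aug_lagrangian f g A B b (x t) (y t) ls - aug_lagrangian f g A B b xs ys ls"

abbreviation E where "E \<equiv> energy f g A B b \<gamma> \<beta> t0 T x y l xs ys ls \<theta> \<eta>"

lemma grad_f: "GDERIV f z :> grad f z" and grad_g: "GDERIV g z' :> grad g z'"
  using f_cont_diff g_cont_diff by (auto simp: cont_diff_def intro: grad_GDERIV)

lemma stationary: "grad f xs = - (transpose A *v ls)" "grad g ys = - (transpose B *v ls)"
  and feasible: "A *v xs + B *v ys = b"
  using saddle by (auto simp: Omega_def)

lemma r_eq: "r t = A *v (x t - xs) + B *v (y t - ys)"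
  unfolding r_def by (simp add: matrix_vector_mult_diff_distrib feasible[symmetric])

lemma t0_le: "t \<in> I \<Longrightarrow> t0 \<le> t"
  by (simp add: tint_def)

lemma t0_mem: "t0 \<in> I"
  using solution by (simp add: solution_S_def Let_def tint_def)

lemma velocities:
  assumes "t \<in> I"
  shows "(x has_vector_derivative x' t) (at t within I)"
    and "(y has_vector_derivative y' t) (at t within I)"
    and "(l has_vector_derivative l' t) (at t within I)"
  using solution assms
  by (auto simp: solution_S_def Let_def C2_on_def intro: has_vector_derivative_tderiv)

lemma accelerations:
  assumes "t \<in> I"
  shows "(x' has_vector_derivative
      - grad f (x t) - transpose A *v (l t + \<delta> t *\<^sub>R l' t) - transpose A *v r t - \<gamma> t *\<^sub>R x' t) (at t within I)"
    and "(y' has_vector_derivative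
      - grad g (y t) - transpose B *v (l t + \<delta> t *\<^sub>R l' t) - transpose B *v r t - \<gamma> t *\<^sub>R y' t) (at t within I)"
    and "(l' has_vector_derivative r t + \<delta> t *\<^sub>R r' t - \<gamma> t *\<^sub>R l' t) (at t within I)"
proof -
  have eqs: "tderiv I x' t + \<gamma> t *\<^sub>R x' t
        = - grad f (x t) - transpose A *v (l t + \<delta> t *\<^sub>R l' t) - transpose A *v r t"
      "tderiv I y' t + \<gamma> t *\<^sub>R y' t
        = - grad g (y t) - transpose B *v (l t + \<delta> t *\<^sub>R l' t) - transpose B *v r t"
      "tderiv I l' t + \<gamma> t *\<^sub>R l' t = A *v (x t + \<delta> t *\<^sub>R x' t) + B *v (y t + \<delta> t *\<^sub>R y' t) - b"
    using solution assms by (auto simp: solution_S_def Let_def r_def)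
  have diff: "x' differentiable_on I" "y' differentiable_on I" "l' differentiable_on I"
    using solution by (auto simp: solution_S_def Let_def C2_on_def)
  show "(x' has_vector_derivative
      - grad f (x t) - transpose A *v (l t + \<delta> t *\<^sub>R l' t) - transpose A *v r t - \<gamma> t *\<^sub>R x' t) (at t within I)"
    using has_vector_derivative_tderiv[OF diff(1) assms] unfolding eqs(1)[symmetric] by simp
  show "(y' has_vector_derivative
      - grad g (y t) - transpose B *v (l t + \<delta> t *\<^sub>R l' t) - transpose B *v r t - \<gamma> t *\<^sub>R y' t) (at t within I)"
    using has_vector_derivative_tderiv[OF diff(2) assms] unfolding eqs(2)[symmetric] by simp
  have "r t + \<delta> t *\<^sub>R r' t = A *v (x t + \<delta> t *\<^sub>R x' t) + B *v (y t + \<delta> t *\<^sub>R y' t) - b"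
    by (simp add: r_def r'_def matrix_vector_right_distrib matrix_vector_mult_scaleR scaleR_right_distrib)
  then show "(l' has_vector_derivative r t + \<delta> t *\<^sub>R r' t - \<gamma> t *\<^sub>R l' t) (at t within I)"
    using has_vector_derivative_tderiv[OF diff(3) assms] unfolding eqs(3)[symmetric] by simp
qed

lemma gap_eq: "gap t = f (x t) - f xs + (g (y t) - g ys) + ls \<bullet> r t + 1 / 2 * (r t \<bullet> r t)"
  by (simp add: gap_def aug_lagrangian_def feasible r_def power2_norm_eq_inner)

text \<open>At the saddle point the gradients are \<open>- A\<^sup>T ls\<close> and \<open>- B\<^sup>T ls\<close>, so the tangent inequalities there add
up to \<open>- ls \<bullet> r\<close>, which cancels the multiplier term of the Lagrangian.\<close>

lemma gap_nonneg: "0 \<le> gap t"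
proof -
  have "grad f xs \<bullet> (x t - xs) \<le> f (x t) - f xs" "grad g ys \<bullet> (y t - ys) \<le> g (y t) - g ys"
    by (intro convex_above_tangent_plane f_convex g_convex grad_f grad_g)+
  moreover have "grad f xs \<bullet> (x t - xs) + grad g ys \<bullet> (y t - ys) = - (ls \<bullet> r t)"
    by (simp add: stationary dot_lmul_matrix r_eq inner_add_right)
  moreover have "0 \<le> r t \<bullet> r t" by simp
  ultimately show ?thesis unfolding gap_eq by linarith
qed

text \<open>The tangent inequalities at the current point; the surplus of one half of \<open>r \<bullet> r\<close> on the right is what the
augmentation term of the Lagrangian leaves over.\<close>

lemma gap_le:
  "gap t \<le> grad f (x t) \<bullet> (x t - xs) + grad g (y t) \<bullet> (y t - ys) + ls \<bullet> r t + r t \<bullet> r t"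
proof -
  have "grad f (x t) \<bullet> (xs - x t) \<le> f xs - f (x t)" "grad g (y t) \<bullet> (ys - y t) \<le> g ys - g (y t)"
    by (intro convex_above_tangent_plane f_convex g_convex grad_f grad_g)+
  moreover have "0 \<le> r t \<bullet> r t" by simp
  ultimately show ?thesis unfolding gap_eq inner_diff_right by linarith
qed

lemma gap_derivative:
  assumes "t \<in> I"
  shows "(gap has_real_derivative
      grad f (x t) \<bullet> x' t + grad g (y t) \<bullet> y' t + (ls + r t) \<bullet> r' t) (at t within I)"
proof -
  have r': "(r has_vector_derivative r' t) (at t within I)"
    unfolding r_def r'_def using velocities[OF assms]
    by (auto intro!: derivative_eq_intros
        bounded_linear.has_vector_derivative[OF matrix_vector_mul_bounded_linear])
  have "((\<lambda>s. r s \<bullet> r s) has_real_derivative 2 * (r t \<bullet> r' t)) (at t within I)"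
    using bounded_bilinear.has_vector_derivative[OF bounded_bilinear_inner r' r']
    by (simp add: has_real_derivative_iff_has_vector_derivative inner_commute)
  moreover have "((\<lambda>s. ls \<bullet> r s) has_real_derivative ls \<bullet> r' t) (at t within I)"
    using bounded_linear.has_vector_derivative[OF bounded_linear_inner_right r']
    by (simp add: has_real_derivative_iff_has_vector_derivative)
  ultimately show ?thesis
    unfolding gap_eq[abs_def] using GDERIV_along_curve[of f x t] GDERIV_along_curve[of g y t]
      grad_f grad_g velocities[OF assms]
    by (auto intro!: derivative_eq_intros simp: inner_add_left)
qed

text \<open>The heart of the energy estimate. The multiplier \<open>l\<close> and its velocity occur in all three pairings, and
because \<open>\<beta>0 \<gamma> \<delta> = 1\<close> all these contributions cancel, leaving only the fixed multiplier \<open>ls\<close>. The second bracket on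
the right is the derivative of the gap, so it cancels against the gap term of the energy; the first is
what convexity compares with the gap itself.\<close>

lemma force_pairing:
  assumes "t \<in> I"
  shows "((\<beta>0 * \<gamma> t) *\<^sub>R (x t - xs) + x' t)
        \<bullet> (- grad f (x t) - transpose A *v (l t + \<delta> t *\<^sub>R l' t) - transpose A *v r t)
      + ((\<beta>0 * \<gamma> t) *\<^sub>R (y t - ys) + y' t)
        \<bullet> (- grad g (y t) - transpose B *v (l t + \<delta> t *\<^sub>R l' t) - transpose B *v r t)
      + ((\<beta>0 * \<gamma> t) *\<^sub>R (l t - ls) + l' t) \<bullet> (r t + \<delta> t *\<^sub>R r' t)
    = - (\<beta>0 * \<gamma> t) * (grad f (x t) \<bullet> (x t - xs) + grad g (y t) \<bullet> (y t - ys) + ls \<bullet> r t + r t \<bullet> r t)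
      - (grad f (x t) \<bullet> x' t + grad g (y t) \<bullet> y' t + (ls + r t) \<bullet> r' t)"
proof -
  define k where "k = \<beta>0 * \<gamma> t"
  have "k * \<delta> t = 1"
    using delta gamma_pos[of t] t0_le[OF assms] beta_pos beta0_ge by (simp add: k_def)
  define X where "X = k *\<^sub>R (x t - xs) + x' t"
  define Y where "Y = k *\<^sub>R (y t - ys) + y' t"
  define m where "m = l t + \<delta> t *\<^sub>R l' t + r t"
  have AB: "A *v X + B *v Y = k *\<^sub>R r t + r' t"
    by (simp add: X_def Y_def r_eq r'_def matrix_vector_right_distrib matrix_vector_mult_scaleR
        scaleR_right_distrib)
  have 1: "X \<bullet> (- grad f (x t) - transpose A *v (l t + \<delta> t *\<^sub>R l' t) - transpose A *v r t)
      = - (grad f (x t) \<bullet> X) - m \<bullet> (A *v X)"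
    by (simp add: m_def inner_diff_right inner_commute[of X] dot_lmul_matrix inner_add_left)
  have 2: "Y \<bullet> (- grad g (y t) - transpose B *v (l t + \<delta> t *\<^sub>R l' t) - transpose B *v r t)
      = - (grad g (y t) \<bullet> Y) - m \<bullet> (B *v Y)"
    by (simp add: m_def inner_diff_right inner_commute[of Y] dot_lmul_matrix inner_add_left)
  have "m \<bullet> (A *v X) + m \<bullet> (B *v Y) = m \<bullet> (k *\<^sub>R r t + r' t)"
    by (simp add: AB flip: inner_add_right)
  moreover have "(k *\<^sub>R (l t - ls) + l' t) \<bullet> (r t + \<delta> t *\<^sub>R r' t) - m \<bullet> (k *\<^sub>R r t + r' t)
      = - k * (ls \<bullet> r t + r t \<bullet> r t) - (ls + r t) \<bullet> r' t
        + (k * \<delta> t - 1) * ((l t - ls) \<bullet> r' t - l' t \<bullet> r t)"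
    by (simp add: m_def inner_simps algebra_simps)
  ultimately show ?thesis
    unfolding k_def[symmetric] X_def[symmetric] Y_def[symmetric] 1 2 using \<open>k * \<delta> t = 1\<close>
    by (simp add: X_def Y_def inner_simps algebra_simps)
qed

text \<open>After the cancellations the derivative is a sum of three nonpositive terms:
a multiple of \<open>2 \<beta> gap - \<beta>0 S\<close> with \<open>gap \<le> S\<close> and \<open>2 \<beta> \<le> \<beta>0\<close>, a multiple of the kinetic energy with factor
\<open>\<beta>0 + \<beta> - 1 < 0\<close>, and \<open>\<kappa>\<close> times the squared distance to the saddle point.\<close>

lemma energy_derivative_nonpos:
  assumes "t \<in> I"
  shows "\<exists>D\<le>0. (E has_real_derivative D) (at t within I)"
proof -
  note t = t0_le[OF assms]
  define S where
    "S = grad f (x t) \<bullet> (x t - xs) + grad g (y t) \<bullet> (y t - ys) + ls \<bullet> r t + r t \<bullet> r t"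
  define gap' where "gap' = grad f (x t) \<bullet> x' t + grad g (y t) \<bullet> y' t + (ls + r t) \<bullet> r' t"
  define V where "V = (norm (x' t))\<^sup>2 + (norm (y' t))\<^sup>2 + (norm (l' t))\<^sup>2"
  define U where "U = (norm (x t - xs))\<^sup>2 + (norm (y t - ys))\<^sup>2 + (norm (l t - ls))\<^sup>2"
  have E_eq: "E = (\<lambda>s. (q s)\<^sup>2 * gap s + energy_part \<gamma> \<beta> t0 T \<theta> \<eta> x xs s
      + energy_part \<gamma> \<beta> t0 T \<theta> \<eta> y ys s + energy_part \<gamma> \<beta> t0 T \<theta> \<eta> l ls s)"
    by (simp add: fun_eq_iff energy_def gap_def q_square)
  have "I \<subseteq> {t0..}" by (auto simp: tint_def)
  then have q': "(q has_real_derivative \<beta> * \<gamma> t * q t) (at t within I)"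
    by (rule DERIV_subset[OF q_derivative[OF t]])
  have "((\<lambda>s. (q s)\<^sup>2 * gap s) has_real_derivative
      2 * \<beta> * \<gamma> t * (q t)\<^sup>2 * gap t + (q t)\<^sup>2 * gap') (at t within I)"
    unfolding gap'_def
    by (rule derivative_eq_intros q' gap_derivative[OF assms] refl)+
      (simp add: power2_eq_square algebra_simps)
  note total = DERIV_add[OF DERIV_add[OF DERIV_add[OF this
      energy_part_derivative[OF refl assms velocities(1)[OF assms] accelerations(1)[OF assms], of xs]]
      energy_part_derivative[OF refl assms velocities(2)[OF assms] accelerations(2)[OF assms], of ys]]
      energy_part_derivative[OF refl assms velocities(3)[OF assms] accelerations(3)[OF assms], of ls],
      folded E_eq]
  have "2 * \<beta> * gap t \<le> \<beta>0 * gap t"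
    using beta0_ge gap_nonneg by (rule mult_right_mono)
  also have "\<dots> \<le> \<beta>0 * S"
    unfolding S_def using beta0_ge beta_pos by (intro mult_left_mono gap_le) simp
  finally have "2 * \<beta> * gap t - \<beta>0 * S \<le> 0" by simp
  then have "(q t)\<^sup>2 * \<gamma> t * (2 * \<beta> * gap t - \<beta>0 * S) \<le> 0"
    using gamma_pos[OF t] by (intro mult_nonneg_nonpos) auto
  moreover have "(q t)\<^sup>2 * \<gamma> t * (\<beta>0 + \<beta> - 1) * V \<le> 0"
    using gamma_pos[OF t] beta0_less by (intro mult_nonpos_nonneg mult_nonneg_nonpos) (auto simp: V_def)
  moreover have "\<kappa> t * U \<le> 0"
    using kappa_nonpos[OF t] by (intro mult_nonpos_nonneg) (auto simp: U_def)
  ultimately show ?thesis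
  proof (intro exI conjI)
    show "(E has_real_derivative (q t)\<^sup>2 * \<gamma> t * (2 * \<beta> * gap t - \<beta>0 * S)
        + (q t)\<^sup>2 * \<gamma> t * (\<beta>0 + \<beta> - 1) * V + \<kappa> t * U) (at t within I)"
    proof (rule DERIV_cong[OF total])
      let ?m = "\<lambda>P Q R. 2 * \<beta> * \<gamma> t * (q t)\<^sup>2 * gap t + (q t)\<^sup>2 * gap'
        + ((q t)\<^sup>2 * \<gamma> t * (\<beta>0 + \<beta> - 1) * (norm (x' t))\<^sup>2 + \<kappa> t * (norm (x t - xs))\<^sup>2 + (q t)\<^sup>2 * P)
        + ((q t)\<^sup>2 * \<gamma> t * (\<beta>0 + \<beta> - 1) * (norm (y' t))\<^sup>2 + \<kappa> t * (norm (y t - ys))\<^sup>2 + (q t)\<^sup>2 * Q)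
        + ((q t)\<^sup>2 * \<gamma> t * (\<beta>0 + \<beta> - 1) * (norm (l' t))\<^sup>2 + \<kappa> t * (norm (l t - ls))\<^sup>2 + (q t)\<^sup>2 * R)"
      have *: "?m P Q R = (q t)\<^sup>2 * \<gamma> t * (2 * \<beta> * gap t - \<beta>0 * S)
          + (q t)\<^sup>2 * \<gamma> t * (\<beta>0 + \<beta> - 1) * V + \<kappa> t * U"
        if "P + Q + R = - (\<beta>0 * \<gamma> t) * S - gap'" for P Q R
      proof -
        have "R = - (\<beta>0 * \<gamma> t) * S - gap' - P - Q" using that by simp
        then show ?thesis by (simp only: V_def U_def) (simp add: algebra_simps)
      qed
      show "?m (((\<beta>0 * \<gamma> t) *\<^sub>R (x t - xs) + x' t)
        \<bullet> (- grad f (x t) - transpose A *v (l t + \<delta> t *\<^sub>R l' t) - transpose A *v r t))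
        (((\<beta>0 * \<gamma> t) *\<^sub>R (y t - ys) + y' t)
        \<bullet> (- grad g (y t) - transpose B *v (l t + \<delta> t *\<^sub>R l' t) - transpose B *v r t))
        (((\<beta>0 * \<gamma> t) *\<^sub>R (l t - ls) + l' t) \<bullet> (r t + \<delta> t *\<^sub>R r' t))
        = (q t)\<^sup>2 * \<gamma> t * (2 * \<beta> * gap t - \<beta>0 * S)
          + (q t)\<^sup>2 * \<gamma> t * (\<beta>0 + \<beta> - 1) * V + \<kappa> t * U"
        by (rule *) (unfold S_def gap'_def, rule force_pairing[OF assms])
    qed
  qed linarith
qed

end

section \<open>The dynamical system as a first-order system\<close>

text \<open>A bound on the unit ball, uniform in the parameter by compactness, is a Lipschitz constant of each linear map.\<close>

lemma linear_family_lipschitz: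
  fixes h :: "'t::topological_space \<Rightarrow> 'a::euclidean_space \<Rightarrow> 'b::real_normed_vector"
  assumes "compact C" and cont: "continuous_on (C \<times> UNIV) (\<lambda>(t, z). h t z)"
    and lin: "\<And>t. linear (h t)"
  obtains K where "\<And>t S. t \<in> C \<Longrightarrow> K-lipschitz_on S (h t)"
proof -
  have "compact ((\<lambda>(t, z). h t z) ` (C \<times> cball 0 1))"
    using \<open>compact C\<close>
    by (intro compact_continuous_image continuous_on_subset[OF cont] compact_Times) auto
  then obtain K where "0 < K" and K: "\<And>t z. t \<in> C \<Longrightarrow> norm z \<le> 1 \<Longrightarrow> norm (h t z) \<le> K"
    by (auto simp: bounded_pos dest!: compact_imp_bounded)
  have le: "norm (h t z) \<le> K * norm z" if "t \<in> C" for t z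
  proof (cases "z = 0")
    case False
    have "norm (h t z) = norm z * norm (h t (z /\<^sub>R norm z))"
      using False by (simp add: linear_scale[OF lin])
    also have "\<dots> \<le> norm z * K"
      using False by (intro mult_left_mono K that) auto
    finally show ?thesis by (simp add: mult.commute)
  qed (simp add: linear_0[OF lin])
  have "K-lipschitz_on S (h t)" if "t \<in> C" for t S
    using le[OF that] \<open>0 < K\<close> by (intro lipschitz_onI) (auto simp: dist_norm simp flip: linear_diff[OF lin])
  then show thesis by (rule that)
qed

text \<open>The dynamical system as a first-order system: the first triple of a state holds the positions
\<open>(x, y, l)\<close>, the second one the velocities.\<close>

definition state_field where
  "state_field f g A B b \<gamma> \<delta> t z = (case z of ((x, y, l), (u, v, w)) \<Rightarrow>
     ((u, v, w),
      (- grad f x - transpose A *v (l + \<delta> t *\<^sub>R w) - transpose A *v (A *v x + B *v y - b) - \<gamma> t *\<^sub>R u,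
       - grad g y - transpose B *v (l + \<delta> t *\<^sub>R w) - transpose B *v (A *v x + B *v y - b) - \<gamma> t *\<^sub>R v,
       A *v (x + \<delta> t *\<^sub>R u) + B *v (y + \<delta> t *\<^sub>R v) - b - \<gamma> t *\<^sub>R w)))"
  for f :: "real^'n1 \<Rightarrow> real" and g :: "real^'n2 \<Rightarrow> real"
    and A :: "real^'n1^'m" and B :: "real^'n2^'m" and b :: "real^'m"
    and \<gamma> \<delta> :: "real \<Rightarrow> real"

lemmas continuous_on_mat_mult = bounded_linear.continuous_on[OF matrix_vector_mul_bounded_linear]

lemma state_field_continuous:
  assumes "continuous_on UNIV (grad f)" and "continuous_on UNIV (grad g)"
    and "continuous_on S \<gamma>" and "continuous_on S \<delta>"
  shows "continuous_on (S \<times> UNIV) (\<lambda>(t, z). state_field f g A B b \<gamma> \<delta> t z)"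
proof -
  note [continuous_intros] = continuous_on_compose2[OF assms(1)] continuous_on_compose2[OF assms(2)]
    continuous_on_compose2[OF assms(3)] continuous_on_compose2[OF assms(4)] continuous_on_mat_mult
  show ?thesis
    unfolding state_field_def case_prod_beta by (intro continuous_intros) auto
qed

text \<open>Everything but the two gradients is affine in the state, with coefficients that are bounded for
times in a compact interval; so the Lipschitz constant is uniform in time.\<close>

lemma state_field_locally_lipschitz:
  fixes f :: "real^'n1 \<Rightarrow> real" and g :: "real^'n2 \<Rightarrow> real"
    and A :: "real^'n1^'m" and B :: "real^'n2^'m"
  assumes f: "locally_lipschitz (grad f)" and g: "locally_lipschitz (grad g)"
    and cont: "continuous_on {t0..c} \<gamma>" "continuous_on {t0..c} \<delta>"
  shows "\<exists>r>0. \<exists>L. \<forall>t\<in>{t0..c}. L-lipschitz_on (cball z r) (state_field f g A B b \<gamma> \<delta> t)"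
proof -
  \<comment> \<open>\<open>h\<close> is the part that is linear in the state, \<open>N\<close> below collects the gradients and the constants.\<close>
  define h where "h t z = (case z of ((x, y, l), (u, v, w)) \<Rightarrow>
     ((u, v, w),
      (- (transpose A *v (l + \<delta> t *\<^sub>R w)) - transpose A *v (A *v x + B *v y) - \<gamma> t *\<^sub>R u,
       - (transpose B *v (l + \<delta> t *\<^sub>R w)) - transpose B *v (A *v x + B *v y) - \<gamma> t *\<^sub>R v,
       A *v (x + \<delta> t *\<^sub>R u) + B *v (y + \<delta> t *\<^sub>R v) - \<gamma> t *\<^sub>R w)))"
    for t and z :: "((real^'n1) \<times> (real^'n2) \<times> (real^'m)) \<times> (real^'n1) \<times> (real^'n2) \<times> (real^'m)"
  have lin: "linear (h t)" for t
    by (rule linearI) (auto simp: h_def matrix_vector_right_distrib matrix_vector_mult_scaleR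
        matrix_vector_mult_diff_distrib algebra_simps simp del: transpose_matrix_vector)
  have conth: "continuous_on ({t0..c} \<times> UNIV) (\<lambda>(t, z). h t z)"
  proof -
    note [continuous_intros] = continuous_on_compose2[OF cont(1)] continuous_on_compose2[OF cont(2)]
      continuous_on_mat_mult
    show ?thesis
      unfolding h_def case_prod_beta by (intro continuous_intros) auto
  qed
  obtain K where K: "\<And>t S. t \<in> {t0..c} \<Longrightarrow> K-lipschitz_on S (h t)"
    using linear_family_lipschitz[OF compact_Icc conth lin] by metis
  obtain r1 L1 where r1: "0 < r1" "L1-lipschitz_on (cball (fst (fst z)) r1) (grad f)"
    using f unfolding locally_lipschitz_def by blast
  obtain r2 L2 where r2: "0 < r2" "L2-lipschitz_on (cball (fst (snd (fst z))) r2) (grad g)"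
    using g unfolding locally_lipschitz_def by blast
  note nonneg = lipschitz_on_nonneg[OF r1(2)] lipschitz_on_nonneg[OF r2(2)]
  define r where "r = min r1 r2"
  define N where "N w = (0::(real^'n1) \<times> (real^'n2) \<times> (real^'m),
      (transpose A *v b - grad f (fst (fst w)), transpose B *v b - grad g (fst (snd (fst w))), - b))"
    for w :: "((real^'n1) \<times> (real^'n2) \<times> (real^'m)) \<times> (real^'n1) \<times> (real^'n2) \<times> (real^'m)"
  have fst_le: "dist (fst (fst w)) (fst (fst w')) \<le> dist w w'"
    and snd_le: "dist (fst (snd (fst w))) (fst (snd (fst w'))) \<le> dist w w'"
    for w w' :: "((real^'n1) \<times> (real^'n2) \<times> (real^'m)) \<times> (real^'n1) \<times> (real^'n2) \<times> (real^'m)"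
    by (meson dist_fst_le dist_snd_le order_trans)+
  have N_lip: "(L1 + L2)-lipschitz_on (cball z r) N"
  proof (rule lipschitz_onI)
    fix w w' assume "w \<in> cball z r" "w' \<in> cball z r"
    then have mem: "fst (fst w) \<in> cball (fst (fst z)) r1" "fst (fst w') \<in> cball (fst (fst z)) r1"
        "fst (snd (fst w)) \<in> cball (fst (snd (fst z))) r2" "fst (snd (fst w')) \<in> cball (fst (snd (fst z))) r2"
      using fst_le[of z w] fst_le[of z w'] snd_le[of z w] snd_le[of z w'] by (simp_all add: r_def)
    let ?df = "grad f (fst (fst w')) - grad f (fst (fst w))"
      and ?dg = "grad g (fst (snd (fst w'))) - grad g (fst (snd (fst w)))"
    have "dist (N w) (N w') = norm (?df, ?dg, 0::real^'m)"
      by (simp add: dist_norm N_def norm_Pair)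
    also have "\<dots> \<le> norm ?df + (norm ?dg + 0)"
      by (rule order_trans[OF norm_Pair_le add_left_mono[OF order_trans[OF norm_Pair_le]]]) simp
    also have "\<dots> \<le> L1 * dist w w' + (L2 * dist w w' + 0)"
    proof (intro add_mono order_refl)
      have "norm ?df \<le> L1 * dist (fst (fst w)) (fst (fst w'))"
        using lipschitz_onD[OF r1(2) mem(1,2)] by (simp add: dist_norm norm_minus_commute)
      also have "\<dots> \<le> L1 * dist w w'" by (intro mult_left_mono fst_le nonneg)
      finally show "norm ?df \<le> L1 * dist w w'" .
      have "norm ?dg \<le> L2 * dist (fst (snd (fst w))) (fst (snd (fst w')))"
        using lipschitz_onD[OF r2(2) mem(3,4)] by (simp add: dist_norm norm_minus_commute)
      also have "\<dots> \<le> L2 * dist w w'" by (intro mult_left_mono snd_le nonneg)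
      finally show "norm ?dg \<le> L2 * dist w w'" .
    qed
    finally show "dist (N w) (N w') \<le> (L1 + L2) * dist w w'" by (simp add: algebra_simps)
  qed (use nonneg in simp)
  have split: "state_field f g A B b \<gamma> \<delta> t = (\<lambda>w. h t w + N w)" for t
    by (auto simp: fun_eq_iff state_field_def h_def N_def matrix_vector_mult_diff_distrib)
  have "(K + (L1 + L2))-lipschitz_on (cball z r) (state_field f g A B b \<gamma> \<delta> t)"
    if "t \<in> {t0..c}" for t
    unfolding split by (rule lipschitz_on_add[OF K[OF that] N_lip])
  moreover have "0 < r" using r1 r2 by (simp add: r_def)
  ultimately show ?thesis by blast
qed

lemma solution_S_of_state:
  fixes f :: "real^'n1 \<Rightarrow> real" and g :: "real^'n2 \<Rightarrow> real"
    and A :: "real^'n1^'m" and B :: "real^'n2^'m" and b :: "real^'m" and \<gamma> \<delta> :: "real \<Rightarrow> real"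
  defines "F \<equiv> state_field f g A B b \<gamma> \<delta>"
  assumes "ereal t0 < T"
    and cont: "continuous_on ({t0..} \<times> UNIV) (\<lambda>(t, z). F t z)"
    and Z: "\<And>t. t \<in> tint t0 T \<Longrightarrow> (Z has_vector_derivative F t (Z t)) (at t within tint t0 T)"
  shows "solution_S f g A B b \<gamma> \<delta> t0 T
      (\<lambda>t. fst (fst (Z t))) (\<lambda>t. fst (snd (fst (Z t)))) (\<lambda>t. snd (snd (fst (Z t))))"
proof -
  let ?I = "tint t0 T"
  have "continuous_on ?I Z"
    by (rule continuous_on_vector_derivative[OF Z])
  then have contF: "continuous_on ?I (\<lambda>t. F t (Z t))"
    using continuous_on_compose2[OF cont continuous_on_Pair[OF continuous_on_id]]
    by (force simp: tint_def)
  note fst' = bounded_linear.has_vector_derivative[OF bounded_linear_fst]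
    and snd' = bounded_linear.has_vector_derivative[OF bounded_linear_snd]
  have velocity: "fst (F t z) = snd z" for t z
    by (simp add: F_def state_field_def case_prod_beta)
  note pos' = fst'[OF Z, unfolded velocity] and vel' = snd'[OF Z]
  note X = C2_on_tintI[OF fst'[OF pos'] fst'[OF vel'] continuous_on_fst[OF continuous_on_snd[OF contF]]]
  note Y = C2_on_tintI[OF fst'[OF snd'[OF pos']] fst'[OF snd'[OF vel']]
      continuous_on_fst[OF continuous_on_snd[OF continuous_on_snd[OF contF]]]]
  note L = C2_on_tintI[OF snd'[OF snd'[OF pos']] snd'[OF snd'[OF vel']]
      continuous_on_snd[OF continuous_on_snd[OF continuous_on_snd[OF contF]]]]
  show ?thesis
    unfolding solution_S_def Let_def
    using \<open>ereal t0 < T\<close> X(1) Y(1) L(1)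
    by (auto simp: X(2,3) Y(2,3) L(2,3)) (simp_all add: F_def state_field_def case_prod_beta)
qed

section \<open>Boundedness and global existence\<close>

context energy_weights
begin

text \<open>On a compact time interval \<open>\<eta>\<close> is bounded away from zero and \<open>\<theta>\<close> is bounded, so a bound on the energy
gives a bound first on \<open>u - us\<close> and then, since \<open>q \<ge> 1\<close>, on the velocity.\<close>

lemma bounded_of_energy_part:
  fixes u :: "real \<Rightarrow> 'a::real_normed_vector"
  assumes "t0 < \<tau>"
    and M: "\<And>t. t \<in> tint t0 (ereal \<tau>) \<Longrightarrow> energy_part \<gamma> \<beta> t0 (ereal \<tau>) \<theta> \<eta> u us t \<le> M"
  shows "bounded (u ` tint t0 (ereal \<tau>))" and "bounded (tderiv (tint t0 (ereal \<tau>)) u ` tint t0 (ereal \<tau>))"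
proof -
  let ?I = "tint t0 (ereal \<tau>)"
  have I: "?I = {t0..<\<tau>}" by (auto simp: tint_def)
  obtain tm where tm: "tm \<in> {t0..\<tau>}" "\<And>t. t \<in> {t0..\<tau>} \<Longrightarrow> \<eta> tm \<le> \<eta> t"
    using continuous_attains_inf[of "{t0..\<tau>}" \<eta>] continuous_on_subset[OF eta_continuous] \<open>t0 < \<tau>\<close>
    by (metis Icc_subset_Ici_iff atLeastatMost_empty_iff2 compact_Icc less_imp_le order_refl)
  obtain tM where tM: "\<And>t. t \<in> {t0..\<tau>} \<Longrightarrow> \<theta> t \<le> \<theta> tM"
    using continuous_attains_sup[of "{t0..\<tau>}" \<theta>] continuous_on_subset[OF theta_continuous] \<open>t0 < \<tau>\<close>
    by (metis Icc_subset_Ici_iff atLeastatMost_empty_iff2 compact_Icc less_imp_le order_refl)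
  define e where "e = \<eta> tm"
  have "0 < e" using tm(1) eta_pos by (simp add: e_def)
  define R where "R = sqrt (2 * M / e)"
  have bounds: "norm (u t - us) \<le> R \<and> norm (tderiv ?I u t) \<le> sqrt (2 * M) + \<theta> tM * R" if t: "t \<in> ?I" for t
  proof -
    define d where "d = u t - us"
    define w where "w = \<theta> t *\<^sub>R d + q t *\<^sub>R tderiv ?I u t"
    have t': "t \<in> {t0..\<tau>}" "t0 \<le> t" using t by (auto simp: I)
    have part: "1 / 2 * (norm w)\<^sup>2 + \<eta> t / 2 * (norm d)\<^sup>2 \<le> M"
      using M[OF t] by (simp add: energy_part_def w_def d_def q_def)
    have "0 \<le> \<eta> t / 2 * (norm d)\<^sup>2" using eta_pos[OF t'(2)] by simp
    then have "(norm w)\<^sup>2 \<le> 2 * M" using part by linarith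
    then have w: "norm w \<le> sqrt (2 * M)" by (rule real_le_rsqrt)
    have "e * (norm d)\<^sup>2 \<le> \<eta> t * (norm d)\<^sup>2"
      using tm(2)[OF t'(1)] by (simp add: e_def mult_right_mono)
    then have "e * (norm d)\<^sup>2 \<le> 2 * M" using part zero_le_power2[of "norm w"] by linarith
    then have "(norm d)\<^sup>2 \<le> 2 * M / e" using \<open>0 < e\<close> by (simp add: field_simps)
    then have d: "norm d \<le> R" unfolding R_def by (rule real_le_rsqrt)
    have "norm (tderiv ?I u t) \<le> q t * norm (tderiv ?I u t)"
      using mult_right_mono[OF q_ge_1[of t] norm_ge_zero[of "tderiv ?I u t"]] by simp
    also have "\<dots> = norm (w - \<theta> t *\<^sub>R d)"
      using q_ge_1[of t] by (simp add: w_def)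
    also have "\<dots> \<le> norm w + \<theta> t * norm d"
      using norm_triangle_ineq4[of w "\<theta> t *\<^sub>R d"] theta_pos[OF t'(2)] by simp
    also have "\<dots> \<le> sqrt (2 * M) + \<theta> tM * R"
      using w d tM[OF t'(1)] theta_pos[OF t'(2)] by (intro add_mono mult_mono) auto
    finally show ?thesis using d by (simp add: d_def)
  qed
  have "norm (u t) \<le> R + norm us" if "t \<in> ?I" for t
    using bounds[OF that] norm_triangle_sub[of "u t" us] by linarith
  then show "bounded (u ` ?I)" by (auto simp: bounded_iff)
  show "bounded (tderiv ?I u ` ?I)" using bounds by (auto simp: bounded_iff)
qed

end

context saddle_trajectory
begin

lemma energy_antimono: "antimono_on I E"
proof -
  obtain D where "\<forall>t\<in>I. D t \<le> 0 \<and> (E has_real_derivative D t) (at t within I)"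
    using bchoice[of I "\<lambda>t D. D \<le> 0 \<and> (E has_real_derivative D) (at t within I)"]
      energy_derivative_nonpos by blast
  then show ?thesis
    by (intro antimono_on_derivative_nonpos[OF is_interval_tint, where u' = D]) auto
qed

lemma energy_part_nonneg:
  "t \<in> I \<Longrightarrow> 0 \<le> energy_part \<gamma> \<beta> t0 T \<theta> \<eta> u us t"
  using eta_pos[OF t0_le, of t] by (simp add: energy_part_def)

lemma energy_parts_le:
  assumes t: "t \<in> I"
  shows "energy_part \<gamma> \<beta> t0 T \<theta> \<eta> x xs t \<le> E t0" "energy_part \<gamma> \<beta> t0 T \<theta> \<eta> y ys t \<le> E t0"
    "energy_part \<gamma> \<beta> t0 T \<theta> \<eta> l ls t \<le> E t0"
proof -
  have "E t \<le> E t0"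
    using monotone_onD[OF energy_antimono t0_mem t t0_le[OF t]] .
  moreover have "E t = (q t)\<^sup>2 * gap t + energy_part \<gamma> \<beta> t0 T \<theta> \<eta> x xs t
      + energy_part \<gamma> \<beta> t0 T \<theta> \<eta> y ys t + energy_part \<gamma> \<beta> t0 T \<theta> \<eta> l ls t"
    by (simp add: energy_def gap_def q_square)
  moreover have "0 \<le> (q t)\<^sup>2 * gap t" by (simp add: gap_nonneg)
  moreover note energy_part_nonneg[OF t, of x xs] energy_part_nonneg[OF t, of y ys]
    energy_part_nonneg[OF t, of l ls]
  ultimately show "energy_part \<gamma> \<beta> t0 T \<theta> \<eta> x xs t \<le> E t0"
      "energy_part \<gamma> \<beta> t0 T \<theta> \<eta> y ys t \<le> E t0" "energy_part \<gamma> \<beta> t0 T \<theta> \<eta> l ls t \<le> E t0"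
    by linarith+
qed

text \<open>Up to a finite time the energy bounds positions and velocities, so the state equation can be
continued, and its position components form a longer solution.\<close>

lemma finite_time_extension:
  assumes T: "T = ereal \<tau>"
    and f_lip: "locally_lipschitz (grad f)" and g_lip: "locally_lipschitz (grad g)"
  shows "\<exists>T' X Y L. T < T' \<and> solution_S f g A B b \<gamma> \<delta> t0 T' X Y L \<and>
    (\<forall>t\<in>I. X t = x t \<and> Y t = y t \<and> L t = l t)"
proof -
  have "t0 < \<tau>" using t0_mem T by (simp add: tint_def)
  have tint_eq: "tint t0 (ereal c) = {t0..<c}" for c by (auto simp: tint_def)
  let ?F = "state_field f g A B b \<gamma> \<delta>"
  define z where "z t = ((x t, y t, l t), (x' t, y' t, l' t))" for t
  have "continuous_on {t0..} (\<lambda>t. 1 / (\<beta>0 * \<gamma> t))"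
    using gamma_pos beta_pos beta0_ge by (intro continuous_intros gamma_continuous) force
  then have delta_continuous: "continuous_on {t0..} \<delta>"
    by (rule continuous_on_cong[THEN iffD1, rotated 2]) (simp_all add: delta)
  have contF: "continuous_on ({t0..} \<times> UNIV) (\<lambda>(t, z). ?F t z)"
    using f_cont_diff g_cont_diff
    by (intro state_field_continuous gamma_continuous delta_continuous) (simp_all add: cont_diff_def)
  note bounded = bounded_of_energy_part[OF \<open>t0 < \<tau>\<close>, folded T]
  have "bounded ((x ` I \<times> y ` I \<times> l ` I) \<times> (x' ` I \<times> y' ` I \<times> l' ` I))"
    by (intro bounded_Times) (rule bounded[OF energy_parts_le(1)] bounded[OF energy_parts_le(2)]
        bounded[OF energy_parts_le(3)], assumption)+
  then have "bounded (z ` {t0..<\<tau>})"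
    by (rule bounded_subset) (auto simp: z_def T tint_eq)
  moreover have "(z has_vector_derivative ?F t (z t)) (at t within {t0..<\<tau>})" if "t \<in> {t0..<\<tau>}" for t
  proof -
    have "t \<in> I" using that by (simp add: T tint_eq)
    have F_eq: "?F t (z t) = ((x' t, y' t, l' t),
        (- grad f (x t) - transpose A *v (l t + \<delta> t *\<^sub>R l' t) - transpose A *v r t - \<gamma> t *\<^sub>R x' t,
         - grad g (y t) - transpose B *v (l t + \<delta> t *\<^sub>R l' t) - transpose B *v r t - \<gamma> t *\<^sub>R y' t,
         r t + \<delta> t *\<^sub>R r' t - \<gamma> t *\<^sub>R l' t))"
      by (simp add: state_field_def z_def r_def r'_def matrix_vector_right_distrib
          matrix_vector_mult_scaleR scaleR_right_distrib)
    have "(z has_vector_derivative ?F t (z t)) (at t within I)"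
      unfolding F_eq unfolding z_def
      by (intro has_vector_derivative_Pair velocities[OF \<open>t \<in> I\<close>] accelerations[OF \<open>t \<in> I\<close>])
    then show ?thesis by (simp add: T tint_eq)
  qed
  moreover have "\<exists>r>0. \<exists>L. \<forall>t\<in>{t0..c}. L-lipschitz_on (cball w r) (?F t)" for c w
    by (intro state_field_locally_lipschitz f_lip g_lip continuous_on_subset[OF gamma_continuous]
        continuous_on_subset[OF delta_continuous]) auto
  ultimately obtain c Z where c: "\<tau> < c" and Zz: "\<And>t. t \<in> {t0..<\<tau>} \<Longrightarrow> Z t = z t"
    and Z: "\<And>t. t \<in> {t0..<c} \<Longrightarrow> (Z has_vector_derivative ?F t (Z t)) (at t within {t0..<c})"
    using ode_solution_continuation[OF \<open>t0 < \<tau>\<close> contF, of z] by metis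
  have "solution_S f g A B b \<gamma> \<delta> t0 (ereal c)
      (\<lambda>t. fst (fst (Z t))) (\<lambda>t. fst (snd (fst (Z t)))) (\<lambda>t. snd (snd (fst (Z t))))"
    using \<open>t0 < \<tau>\<close> c by (intro solution_S_of_state contF) (simp_all add: tint_eq Z)
  moreover have "T < ereal c" using c by (simp add: T)
  moreover have "fst (fst (Z t)) = x t \<and> fst (snd (fst (Z t))) = y t \<and> snd (snd (fst (Z t))) = l t"
    if "t \<in> I" for t
    using that Zz[of t] by (simp add: T tint_eq z_def)
  ultimately show ?thesis by blast
qed

end

theorem theorem2p2:
  fixes f :: "real^'n1 \<Rightarrow> real" and g :: "real^'n2 \<Rightarrow> real"
    and A :: "real^'n1^'m" and B :: "real^'n2^'m" and b :: "real^'m"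
    and \<gamma> \<delta> :: "real \<Rightarrow> real" and \<beta> \<beta>0 t0 :: real and T :: ereal
    and x :: "real \<Rightarrow> real^'n1" and y :: "real \<Rightarrow> real^'n2" and l :: "real \<Rightarrow> real^'m"
    and xs :: "real^'n1" and ys :: "real^'n2" and ls :: "real^'m"
  assumes "t0 > 0"
    and "convex_on UNIV f" and "cont_diff f" and "locally_lipschitz (grad f)"
    and "convex_on UNIV g" and "cont_diff g" and "locally_lipschitz (grad g)"
    and "\<forall>t\<ge>t0. \<gamma> t > 0" and "antimono_on {t0..} \<gamma>" and "C2_on {t0..} \<gamma>"
    and "0 < \<beta>" and "\<beta> < 1/3"
    and "\<forall>t\<ge>t0. tderiv {t0..} (tderiv {t0..} \<gamma>) t \<ge> 2 * \<beta>\<^sup>2 * (\<gamma> t)^3"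
    and "2 * \<beta> \<le> \<beta>0" and "\<beta>0 < 1 - \<beta>"
    and "\<forall>t\<ge>t0. \<delta> t = 1 / (\<beta>0 * \<gamma> t)"
    and "(xs, ys, ls) \<in> Omega f g A B b"
    and "maximal_solution_S f g A B b \<gamma> \<delta> t0 T x y l"
  shows "(\<exists>\<theta> \<eta> :: real \<Rightarrow> real.
            (\<forall>t\<ge>t0. \<theta> t > 0 \<and> \<eta> t > 0) \<and>
            energy f g A B b \<gamma> \<beta> t0 T x y l xs ys ls \<theta> \<eta> differentiable_on tint t0 T \<and>
            (\<forall>t\<in>tint t0 T.
               tderiv (tint t0 T) (energy f g A B b \<gamma> \<beta> t0 T x y l xs ys ls \<theta> \<eta>) t \<le> 0) \<and>
            antimono_on (tint t0 T) (energy f g A B b \<gamma> \<beta> t0 T x y l xs ys ls \<theta> \<eta>))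
         \<and> T = \<infinity>"
proof -
  have solution: "solution_S f g A B b \<gamma> \<delta> t0 T x y l"
    using assms by (simp add: maximal_solution_S_def)
  interpret saddle_trajectory \<gamma> \<beta> t0 \<beta>0 f g A B b \<delta> T x y l xs ys ls
    using assms solution by unfold_locales auto
  have der: "\<exists>D\<le>0. (E has_vector_derivative D) (at t within I)" if "t \<in> I" for t
    using energy_derivative_nonpos[OF that] by (simp add: has_real_derivative_iff_has_vector_derivative)
  have "E differentiable_on I"
    unfolding differentiable_on_def using der differentiableI_vector by blast
  moreover have "\<forall>t\<in>I. tderiv I E t \<le> 0"
    using der tderiv_eqI by metis
  ultimately have "\<exists>\<theta> \<eta> :: real \<Rightarrow> real. (\<forall>t\<ge>t0. \<theta> t > 0 \<and> \<eta> t > 0) \<and>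
      energy f g A B b \<gamma> \<beta> t0 T x y l xs ys ls \<theta> \<eta> differentiable_on I \<and>
      (\<forall>t\<in>I. tderiv I (energy f g A B b \<gamma> \<beta> t0 T x y l xs ys ls \<theta> \<eta>) t \<le> 0) \<and>
      antimono_on I (energy f g A B b \<gamma> \<beta> t0 T x y l xs ys ls \<theta> \<eta>)"
    using theta_pos eta_pos energy_antimono by blast
  moreover have "T = \<infinity>"
  proof (cases T)
    case (real \<tau>)
    then show ?thesis
      using finite_time_extension[OF real] assms by (simp add: maximal_solution_S_def)
  next
    case MInf
    then show ?thesis using solution by (simp add: solution_S_def Let_def)
  qed simp
  ultimately show ?thesis by blast
qed

end
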